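(* Let $k$ be a field of characteristic $p>0$, let $R=k[x_{i,j} : 1\le i\le p,\ j\ge 1]$, and let the symmetric group $\mathfrak{S}_p$ act on $R$ by permuting the first index, $\sigma(x_{i,j})=x_{\sigma(i),j}$. Let $P\subset R$ be the algebra of polarizations, i.e. the $\mathbf{GL}$-stable $k$-subalgebra of $R$ generated by the elementary symmetric polynomials $E_1(x_1),\dots,E_p(x_1)$ in the $p$ variables $x_{1,1},x_{2,1},\dots,x_{p,1}$. Then for every $f\in R^{\mathfrak{S}_p}$, the element $f^p$ lies in $P$.
   Context: $k$ is a field of characteristic $p>0$; $\mathbf{V}$ is the $k$-vector space with basis $e_1,e_2,\dots$ and $\mathbf{GL}$ is its group of $k$-linear automorphisms. The ring $R=k[x_{i,j}: 1\le i\le p, j\ge 1]$ is identified with $\mathrm{Sym}(k^p\otimes\mathbf{V})$, with $x_{i,j}$ corresponding to (the $i$-th basis vector of $k^p$)$\otimes e_j$. An element $g\in \mathbf{GL}$ with $g e_j=\sum_l g_{lj}e_l$ acts by the algebra automorphism $x_{i,j}\mapsto \sum_l g_{lj}x_{i,l}$; this commutes with the $\mathfrak{S}_p$-action. For $1\le r\le p$ and $j\ge 1$, $E_r(x_j)=\sum_{1\le i_1<\dots<i_r\le p} x_{i_1,j}x_{i_2,j}\cdots x_{i_r,j}$. Convention on representations: all $\mathbf{GL}$-representations are polynomial representations (equivalently, strict polynomial functors over $k$), and "$\mathbf{GL}$-stable" is meant in that sense. Concretely, a $k$-subspace $W\subset R$ is $\mathbf{GL}$-stable if for every commutative $k$-algebra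 $A$, every $N\ge 1$ and every $g\in GL_N(A)$ (acting $A$-linearly on $\mathbf{V}\otimes A$ through the first $N$ basis vectors and fixing the others), the induced automorphism of $R\otimes_k A$ preserves (the image of) $W\otimes_k A$. When $k$ is infinite this is the same as being stable under the abstract group $\mathbf{GL}$. Thus $P$ is the smallest $k$-subalgebra of $R$ that is $\mathbf{GL}$-stable and contains $E_1(x_1),\dots,E_p(x_1)$. *)

theory Defs
  imports
    "HOL-Library.Poly_Mapping"
    "HOL-Combinatorics.Permutations"
    "HOL-Algebra.Algebraic_Closure_Type"
begin

type_synonym monom = "(nat \<times> nat) \<Rightarrow>\<^sub>0 nat"
type_synonym 'k mpol = "monom \<Rightarrow>\<^sub>0 'k"

text \<open>The pair \<open>(i, j)\<close> names the variable \<open>x\<^bsub>i,j\<^esub>\<close>. The ring \<open>R\<close> consists of those elements of the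
  polynomial ring \<open>'k mpol\<close> that involve only variables with \<open>1 \<le> i \<le> p\<close> and \<open>j \<ge> 1\<close>.\<close>

definition vars :: "nat \<Rightarrow> (nat \<times> nat) set" where
  "vars p = {1..p} \<times> {1..}"

definition R_ring :: "nat \<Rightarrow> 'k::field mpol set" where
  "R_ring p = {f. \<forall>m \<in> Poly_Mapping.keys f. Poly_Mapping.keys m \<subseteq> vars p}"

definition mconst :: "'k::field \<Rightarrow> 'k mpol" where
  "mconst c = Poly_Mapping.single 0 c"

definition mvar :: "nat \<Rightarrow> nat \<Rightarrow> 'k::field mpol" where
  "mvar i j = Poly_Mapping.single (Poly_Mapping.single (i, j) 1) 1"

definition perm_act :: "(nat \<Rightarrow> nat) \<Rightarrow> 'k::field mpol \<Rightarrow> 'k mpol" where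
  "perm_act \<sigma> f = (\<Sum>m \<in> Poly_Mapping.keys f. mconst (Poly_Mapping.lookup f m) *
     (\<Prod>(i, j) \<in> Poly_Mapping.keys m. mvar (\<sigma> i) j ^ Poly_Mapping.lookup m (i, j)))"

definition invariants :: "nat \<Rightarrow> 'k::field mpol set" where
  "invariants p = {f \<in> R_ring p. \<forall>\<sigma>. \<sigma> permutes {1..p} \<longrightarrow> perm_act \<sigma> f = f}"

text \<open>\<open>E\<^sub>r(x\<^sub>j)\<close>; the index sets \<open>I\<close> correspond to the tuples \<open>i\<^sub>1 < \<dots> < i\<^sub>r\<close>.\<close>

definition elem_sym :: "nat \<Rightarrow> nat \<Rightarrow> nat \<Rightarrow> 'k::field mpol" where
  "elem_sym p r j = (\<Sum>I | I \<subseteq> {1..p} \<and> card I = r. \<Prod>i\<in>I. mvar i j)"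

definition is_subalgebra :: "nat \<Rightarrow> 'k::field mpol set \<Rightarrow> bool" where
  "is_subalgebra p W \<longleftrightarrow> W \<subseteq> R_ring p \<and> 1 \<in> W \<and>
     (\<forall>f\<in>W. \<forall>g\<in>W. f + g \<in> W \<and> f * g \<in> W) \<and> (\<forall>c. \<forall>f\<in>W. mconst c * f \<in> W)"

text \<open>For a commutative ring \<open>A\<close> the polynomial ring \<open>A[x\<^sub>v : v \<in> V]\<close>, whose elements are given by
  their families of coefficients. For \<open>V = vars p\<close> and a \<open>k\<close>-algebra \<open>A\<close> this is \<open>R \<otimes>\<^sub>k A\<close>.\<close>

definition mpoly_ring :: "(nat \<times> nat) set \<Rightarrow> 'a ring \<Rightarrow> (monom \<Rightarrow> 'a) ring" where
  "mpoly_ring V A = \<lparr>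
     carrier = {f. (\<forall>m. f m \<in> carrier A) \<and> finite {m. f m \<noteq> \<zero>\<^bsub>A\<^esub>} \<and>
                   (\<forall>m. f m \<noteq> \<zero>\<^bsub>A\<^esub> \<longrightarrow> Poly_Mapping.keys m \<subseteq> V)},
     monoid.mult = (\<lambda>f g m. finsum A (\<lambda>(a, b). f a \<otimes>\<^bsub>A\<^esub> g b) {(a, b). a + b = m}),
     one = (\<lambda>m. if m = 0 then \<one>\<^bsub>A\<^esub> else \<zero>\<^bsub>A\<^esub>),
     ring.zero = (\<lambda>m. \<zero>\<^bsub>A\<^esub>),
     add = (\<lambda>f g m. f m \<oplus>\<^bsub>A\<^esub> g m)\<rparr>"

definition A_const :: "'a ring \<Rightarrow> 'a \<Rightarrow> monom \<Rightarrow> 'a" where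
  "A_const A c = (\<lambda>m. if m = 0 then c else \<zero>\<^bsub>A\<^esub>)"

definition A_var :: "'a ring \<Rightarrow> nat \<Rightarrow> nat \<Rightarrow> monom \<Rightarrow> 'a" where
  "A_var A i j = (\<lambda>m. if m = Poly_Mapping.single (i, j) 1 then \<one>\<^bsub>A\<^esub> else \<zero>\<^bsub>A\<^esub>)"

text \<open>\<open>GL\<^sub>N(A)\<close>, with matrices indexed by \<open>{1..N}\<close>; entries outside that range are never used.\<close>

definition GL :: "nat \<Rightarrow> 'a ring \<Rightarrow> (nat \<Rightarrow> nat \<Rightarrow> 'a) set" where
  "GL N A = {g. (\<forall>i\<in>{1..N}. \<forall>j\<in>{1..N}. g i j \<in> carrier A) \<and>
     (\<exists>h. (\<forall>i\<in>{1..N}. \<forall>j\<in>{1..N}. h i j \<in> carrier A) \<and>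
        (\<forall>i\<in>{1..N}. \<forall>j\<in>{1..N}.
           (\<Oplus>\<^bsub>A\<^esub>l\<in>{1..N}. g i l \<otimes>\<^bsub>A\<^esub> h l j) = (if i = j then \<one>\<^bsub>A\<^esub> else \<zero>\<^bsub>A\<^esub>) \<and>
           (\<Oplus>\<^bsub>A\<^esub>l\<in>{1..N}. h i l \<otimes>\<^bsub>A\<^esub> g l j) = (if i = j then \<one>\<^bsub>A\<^esub> else \<zero>\<^bsub>A\<^esub>)))}"

definition gl_var ::
    "nat \<Rightarrow> 'a ring \<Rightarrow> nat \<Rightarrow> (nat \<Rightarrow> nat \<Rightarrow> 'a) \<Rightarrow> nat \<Rightarrow> nat \<Rightarrow> monom \<Rightarrow> 'a" where
  "gl_var p A N g i j =
     (if j \<in> {1..N}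
      then \<Oplus>\<^bsub>mpoly_ring (vars p) A\<^esub>l\<in>{1..N}. A_const A (g l j) \<otimes>\<^bsub>mpoly_ring (vars p) A\<^esub> A_var A i l
      else A_var A i j)"

definition gl_act ::
    "nat \<Rightarrow> 'a ring \<Rightarrow> nat \<Rightarrow> (nat \<Rightarrow> nat \<Rightarrow> 'a) \<Rightarrow> (monom \<Rightarrow> 'a) \<Rightarrow> monom \<Rightarrow> 'a" where
  "gl_act p A N g f = (let S = mpoly_ring (vars p) A in
     \<Oplus>\<^bsub>S\<^esub>m \<in> {m. f m \<noteq> \<zero>\<^bsub>A\<^esub>}. A_const A (f m) \<otimes>\<^bsub>S\<^esub>
       finprod S (\<lambda>(i, j). gl_var p A N g i j [^]\<^bsub>S\<^esub> Poly_Mapping.lookup m (i, j)) (Poly_Mapping.keys m))"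

text \<open>The image of \<open>W \<otimes>\<^sub>k A\<close> in \<open>R \<otimes>\<^sub>k A\<close>, for a \<open>k\<close>-algebra \<open>A\<close> with structure map \<open>\<phi>\<close>.\<close>

definition base_change ::
    "nat \<Rightarrow> 'a ring \<Rightarrow> ('k::field \<Rightarrow> 'a) \<Rightarrow> 'k mpol set \<Rightarrow> (monom \<Rightarrow> 'a) set" where
  "base_change p A \<phi> W = (let S = mpoly_ring (vars p) A in
     {\<Oplus>\<^bsub>S\<^esub>w\<in>F. A_const A (c w) \<otimes>\<^bsub>S\<^esub> (\<lambda>m. \<phi> (Poly_Mapping.lookup w m)) | F c.
        finite F \<and> F \<subseteq> W \<and> c ` F \<subseteq> carrier A})"

text \<open>A quantifier cannot range over all types, so the commutative \<open>k\<close>-algebras \<open>A\<close> are those whose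
  carrier is a subset of \<open>(nat \<Rightarrow>\<^sub>0 nat) \<Rightarrow>\<^sub>0 'k\<close>, the type of polynomials over \<open>k\<close> in countably many
  variables. Up to isomorphism this includes every countably generated commutative \<open>k\<close>-algebra: it
  is a quotient of that polynomial ring, and a section of the quotient map embeds its carrier. This
  loses nothing, because the condition for arbitrary \<open>A\<close> follows from the one for finitely
  generated \<open>A\<close>: an element of \<open>GL\<^sub>N(A)\<close>, its inverse and an element of \<open>W \<otimes>\<^sub>k A\<close> are all defined
  over a finitely generated subalgebra of \<open>A\<close>.\<close>

definition gl_stable :: "nat \<Rightarrow> 'k::field mpol set \<Rightarrow> bool" where
  "gl_stable p W \<longleftrightarrow>
     (\<forall>(A :: ((nat \<Rightarrow>\<^sub>0 nat) \<Rightarrow>\<^sub>0 'k) ring) \<phi> N g.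
        cring A \<and> \<phi> \<in> ring_hom (ring_of_type_algebra :: 'k ring) A \<and> N \<ge> 1 \<and> g \<in> GL N A \<longrightarrow>
        gl_act p A N g ` base_change p A \<phi> W \<subseteq> base_change p A \<phi> W)"

definition polarizations :: "nat \<Rightarrow> 'k::field mpol set" where
  "polarizations p =
     \<Inter>{W. is_subalgebra p W \<and> gl_stable p W \<and> (\<forall>r\<in>{1..p}. elem_sym p r 1 \<in> W)}"

end

theory Submission
  imports Defs
begin

text \<open>Let \<open>W\<close> be a \<open>GL\<close>-stable subalgebra that contains the \<open>E\<^sub>r(x\<^sub>1)\<close>, and let
  \<open>L\<^sub>i = x\<^bsub>i,1\<^esub> + \<Sum>\<^bsub>j>1\<^esub> t\<^sub>j x\<^bsub>i,j\<^esub>\<close> be generic linear forms. By stability, the elementary symmetric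
  polynomials of \<open>L\<^sub>1, \<dots>, L\<^sub>p\<close> have coefficients in \<open>W\<close>. Hence, by Newton's identities, so do the
  power sums of the \<open>L\<^sub>i\<close>, and every power of \<open>L\<^sub>i\<close> is a combination of \<open>1, L\<^sub>i, \<dots>, L\<^sub>i\<^sup>p\<^sup>-\<^sup>1\<close> with
  coefficients in \<open>W[t]\<close> that do not depend on \<open>i\<close>.

  Let \<open>U\<close> be the \<open>W\<close>-span of the coefficients of \<open>1, L\<^sub>i, \<dots>, L\<^sub>i\<^sup>p\<^sup>-\<^sup>1\<close> as families indexed by \<open>i\<close>. In
  characteristic \<open>p\<close>, \<open>L\<^sub>i\<^sup>p\<^sup>+\<^sup>m = (x\<^bsub>i,1\<^esub>\<^sup>p + \<Sum>\<^bsub>j>1\<^esub> t\<^sub>j\<^sup>p x\<^bsub>i,j\<^esub>\<^sup>p) L\<^sub>i\<^sup>m\<close>, and \<open>L\<^sub>i\<^sup>m\<close> has degree less than \<open>p\<close> in every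
  \<open>t\<^sub>j\<close> when \<open>m < p\<close>; comparing coefficients gives \<open>x\<^bsub>i,j\<^esub>\<^sup>p U \<subseteq> U\<close>. Summing over \<open>i\<close> shows that
  \<open>\<Sum>\<^sub>i u(x\<^sub>i)\<^sup>p \<in> W\<close> for every monomial \<open>u\<close>, and therefore the sum over all permutations of the \<open>p\<close>-th
  power of a monomial lies in \<open>W\<close>. A monomial with equal rows is a product of norms
  \<open>\<Prod>\<^sub>i x\<^bsub>i,j\<^esub> \<in> W\<close>; for the others, the order of the stabilizer is prime to \<open>p\<close>,
  so that the sum over the orbit also lies in \<open>W\<close>.\<close>

subsection \<open>Power sums over a subring\<close>

locale unital_subring =
  fixes B :: "'a::comm_ring_1 set"
  assumes one_mem: "1 \<in> B"
    and add_mem: "x \<in> B \<Longrightarrow> y \<in> B \<Longrightarrow> x + y \<in> B"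
    and mult_mem: "x \<in> B \<Longrightarrow> y \<in> B \<Longrightarrow> x * y \<in> B"
    and uminus_mem: "x \<in> B \<Longrightarrow> - x \<in> B"
begin

lemma diff_mem: "x \<in> B \<Longrightarrow> y \<in> B \<Longrightarrow> x - y \<in> B"
  using add_mem[of x "- y"] uminus_mem[of y] by simp

lemma zero_mem: "0 \<in> B"
  using diff_mem[OF one_mem one_mem] by simp

lemma sum_mem: "(\<And>i. i \<in> I \<Longrightarrow> f i \<in> B) \<Longrightarrow> sum f I \<in> B"
  by (induction I rule: infinite_finite_induct) (auto intro: zero_mem add_mem)

lemma prod_mem: "(\<And>i. i \<in> I \<Longrightarrow> f i \<in> B) \<Longrightarrow> prod f I \<in> B"
  by (induction I rule: infinite_finite_induct) (auto intro: one_mem mult_mem)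

lemma power_mem: "x \<in> B \<Longrightarrow> x ^ n \<in> B"
  by (induction n) (auto intro: one_mem mult_mem)

lemma of_nat_mem: "of_nat n \<in> B"
  by (induction n) (auto intro: zero_mem one_mem add_mem)

end

section \<open>Elementary symmetric functions of a finite family and Newton's identities\<close>

definition esym :: "('i \<Rightarrow> 'a::comm_ring_1) \<Rightarrow> 'i set \<Rightarrow> nat \<Rightarrow> 'a" where
  "esym l S r = (\<Sum>I | I \<subseteq> S \<and> card I = r. \<Prod>i\<in>I. l i)"

lemma esym_0: "finite S \<Longrightarrow> esym l S 0 = 1"
proof -
  assume "finite S"
  then have "{I. I \<subseteq> S \<and> card I = 0} = {{}}"
    by (auto simp: finite_subset card_eq_0_iff)
  then show ?thesis by (simp add: esym_def)
qed

lemma esym_eq_0: "finite S \<Longrightarrow> card S < r \<Longrightarrow> esym l S r = 0"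
proof -
  assume "finite S" "card S < r"
  then have "{I. I \<subseteq> S \<and> card I = r} = {}"
    using card_mono leD by blast
  then show ?thesis by (simp only: esym_def sum.empty)
qed

lemma esym_card: "finite S \<Longrightarrow> esym l S (card S) = (\<Prod>i\<in>S. l i)"
proof -
  assume S: "finite S"
  then have "{I. I \<subseteq> S \<and> card I = card S} = {S}"
    using card_subset_eq by blast
  then show ?thesis by (simp add: esym_def)
qed

lemma esym_remove:
  assumes S: "finite S" and a: "a \<in> S"
  shows "esym l S (Suc r) = esym l (S - {a}) (Suc r) + l a * esym l (S - {a}) r"
proof -
  let ?T = "S - {a}"
  have eq: "{I. I \<subseteq> S \<and> card I = Suc r}
      = {I. I \<subseteq> ?T \<and> card I = Suc r} \<union> insert a ` {I. I \<subseteq> ?T \<and> card I = r}" (is "?A = ?C \<union> ?D")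
  proof (intro equalityI subsetI)
    fix I assume I: "I \<in> ?A"
    then have fI: "finite I" using S finite_subset by auto
    show "I \<in> ?C \<union> ?D"
    proof (cases "a \<in> I")
      case True
      then have "I - {a} \<subseteq> ?T" "card (I - {a}) = r" "I = insert a (I - {a})"
        using I fI by auto
      then show ?thesis by blast
    qed (use I in auto)
  next
    fix I assume "I \<in> ?C \<union> ?D"
    then show "I \<in> ?A"
    proof
      assume "I \<in> ?D"
      then obtain J where J: "J \<subseteq> ?T" "card J = r" "I = insert a J" by auto
      have "finite J" using J S finite_subset by auto
      moreover have "a \<notin> J" using J by auto
      ultimately show ?thesis using J a by auto
    qed auto
  qed
  have inj: "inj_on (insert a) {I. I \<subseteq> ?T \<and> card I = r}"
    by (auto simp: inj_on_def)
  have dis: "?C \<inter> ?D = {}" by auto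
  have fin: "finite ?C" "finite ?D"
    using S by (auto intro: finite_subset[of _ "Pow S"])
  have D: "(\<Sum>I\<in>?D. \<Prod>i\<in>I. l i) = l a * esym l ?T r"
  proof -
    have "(\<Sum>I\<in>?D. \<Prod>i\<in>I. l i) = (\<Sum>I | I \<subseteq> ?T \<and> card I = r. \<Prod>i\<in>insert a I. l i)"
      by (subst sum.reindex[OF inj]) simp
    also have "\<dots> = (\<Sum>I | I \<subseteq> ?T \<and> card I = r. l a * (\<Prod>i\<in>I. l i))"
    proof (rule sum.cong[OF refl])
      fix I assume "I \<in> {I. I \<subseteq> ?T \<and> card I = r}"
      then have "finite I" "a \<notin> I" using S finite_subset by auto
      then show "(\<Prod>i\<in>insert a I. l i) = l a * (\<Prod>i\<in>I. l i)" by simp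
    qed
    finally show ?thesis by (simp add: esym_def sum_distrib_left)
  qed
  show ?thesis
    unfolding esym_def[of l S] eq sum.union_disjoint[OF fin dis] D by (simp add: esym_def)
qed

text \<open>Iterating \<open>esym_remove\<close> divides the generating polynomial, the product of
  all \<open>1 + l b * T\<close>, by its factor \<open>1 + l a * T\<close>; the quotient is expanded
  as a geometric series.\<close>

lemma esym_remove_expand:
  assumes S: "finite S" and a: "a \<in> S"
  shows "esym l (S - {a}) r = (\<Sum>s\<le>r. (- l a) ^ s * esym l S (r - s))"
proof (induction r)
  case 0
  then show ?case using S by (simp add: esym_0)
next
  case (Suc r)
  have "esym l (S - {a}) (Suc r) = esym l S (Suc r) - l a * esym l (S - {a}) r"
    using esym_remove[OF assms, of l r] by simp
  also have "\<dots> = esym l S (Suc r) + (\<Sum>s\<le>r. (- l a) ^ Suc s * esym l S (Suc r - Suc s))"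
    by (simp add: Suc sum_distrib_left sum_negf[symmetric] mult.assoc)
  also have "\<dots> = (\<Sum>s\<le>Suc r. (- l a) ^ s * esym l S (Suc r - s))"
    by (subst sum.atMost_Suc_shift) simp
  finally show ?case .
qed

text \<open>Double counting: an \<open>r\<close>-subset of \<open>S\<close> survives the removal of
  \<open>a\<close> exactly for the \<open>card S - r\<close> elements \<open>a\<close> outside
  it.\<close>

lemma sum_esym_remove:
  assumes S: "finite S"
  shows "(\<Sum>a\<in>S. esym l (S - {a}) r) = of_nat (card S - r) * esym l S r"
proof -
  have fin: "finite {I. I \<subseteq> S \<and> card I = r}"
    using S by (auto intro: finite_subset[of _ "Pow S"])
  have "(\<Sum>a\<in>S. esym l (S - {a}) r)
      = (\<Sum>a\<in>S. \<Sum>I | I \<in> {I. I \<subseteq> S \<and> card I = r} \<and> a \<notin> I. \<Prod>i\<in>I. l i)"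
    unfolding esym_def by (intro sum.cong refl) auto
  also have "\<dots> = (\<Sum>I | I \<subseteq> S \<and> card I = r. \<Sum>a | a \<in> S \<and> a \<notin> I. \<Prod>i\<in>I. l i)"
    using S fin by (rule sum.swap_restrict)
  also have "\<dots> = (\<Sum>I | I \<subseteq> S \<and> card I = r. of_nat (card S - r) * (\<Prod>i\<in>I. l i))"
  proof (rule sum.cong[OF refl])
    fix I assume I: "I \<in> {I. I \<subseteq> S \<and> card I = r}"
    have "{a. a \<in> S \<and> a \<notin> I} = S - I" by auto
    moreover have "card (S - I) = card S - r"
      using I S by (auto simp: card_Diff_subset finite_subset)
    ultimately show "(\<Sum>a | a \<in> S \<and> a \<notin> I. \<Prod>i\<in>I. l i) = of_nat (card S - r) * (\<Prod>i\<in>I. l i)"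
      by simp
  qed
  finally show ?thesis by (simp add: esym_def sum_distrib_left)
qed

context unital_subring
begin

text \<open>Newton's identities, by summing \<open>esym_remove_expand\<close> over \<open>a\<close>:
  the term \<open>s = r\<close> has coefficient \<open>esym l S 0 = 1\<close>, so power sums come
  from lower ones without division. Working with powers of \<open>- l a\<close> absorbs the
  signs.\<close>

lemma power_sum_mem:
  assumes S: "finite S" and e: "\<And>r. esym l S r \<in> B"
  shows "(\<Sum>a\<in>S. l a ^ r) \<in> B"
proof -
  have "(\<Sum>a\<in>S. (- l a) ^ r) \<in> B"
  proof (induction r rule: less_induct)
    case (less r)
    have "of_nat (card S - r) * esym l S r = (\<Sum>a\<in>S. \<Sum>s\<le>r. (- l a) ^ s * esym l S (r - s))"
      by (simp add: sum_esym_remove[OF S, symmetric] esym_remove_expand[OF S])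
    also have "\<dots> = (\<Sum>s\<le>r. (\<Sum>a\<in>S. (- l a) ^ s) * esym l S (r - s))"
      by (subst sum.swap) (simp add: sum_distrib_right)
    also have "{..r} = insert r {..<r}" by auto
    finally have "(\<Sum>a\<in>S. (- l a) ^ r)
        = of_nat (card S - r) * esym l S r - (\<Sum>s<r. (\<Sum>a\<in>S. (- l a) ^ s) * esym l S (r - s))"
      using S by (simp add: esym_0 algebra_simps)
    also have "\<dots> \<in> B"
      by (intro diff_mem mult_mem of_nat_mem e sum_mem less) auto
    finally show ?case .
  qed
  then have "(- 1) ^ r * (\<Sum>a\<in>S. (- l a) ^ r) \<in> B"
    by (intro mult_mem power_mem uminus_mem one_mem)
  then show ?thesis
    by (simp add: sum_distrib_left power_mult_distrib[symmetric])
qed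

text \<open>Each \<open>l a\<close> is a root of the monic polynomial whose roots are all the
  \<open>l b\<close>. Its coefficients are elementary symmetric up to sign, so \<open>c\<close> can
  be chosen before \<open>a\<close>.\<close>

lemma power_reduction:
  assumes S: "finite S" "S \<noteq> {}" and e: "\<And>r. esym l S r \<in> B"
  shows "\<exists>c. range c \<subseteq> B \<and> (\<forall>a\<in>S. l a ^ n = (\<Sum>m<card S. c m * l a ^ m))"
proof (induction n)
  case 0
  let ?c = "\<lambda>m. if m = 0 then 1 else 0"
  have "range ?c \<subseteq> B" by (auto intro: zero_mem one_mem)
  moreover have "(\<Sum>m<card S. ?c m * l a ^ m) = 1" for a
  proof -
    have "(\<Sum>m<card S. ?c m * l a ^ m) = (\<Sum>m\<in>{0}. ?c m * l a ^ m)"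
      using S by (intro sum.mono_neutral_right) (auto simp: card_gt_0_iff)
    then show ?thesis by simp
  qed
  ultimately show ?case by (metis power_0)
next
  case (Suc n)
  then obtain c where c: "range c \<subseteq> B" "\<forall>a\<in>S. l a ^ n = (\<Sum>m<card S. c m * l a ^ m)" by blast
  obtain k where k: "card S = Suc k"
    using S by (metis card_eq_0_iff not0_implies_Suc)
  define d where "d m = - ((-1) ^ (Suc k + m) * esym l S (Suc k - m))" for m
  have d: "d m \<in> B" for m
    unfolding d_def by (intro uminus_mem mult_mem power_mem e one_mem)
  \<comment> \<open>Only \<open>k\<close> elements remain after removing \<open>a\<close>, so the
    elementary symmetric function of degree \<open>Suc k\<close> vanishes; its expansion in powers
    of \<open>- l a\<close> is the monic equation for \<open>l a\<close>.\<close>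
  have red: "l a ^ Suc k = (\<Sum>m<Suc k. d m * l a ^ m)" if a: "a \<in> S" for a
  proof -
    have "0 = esym l (S - {a}) (Suc k)"
      using S a k by (subst esym_eq_0) auto
    also have "\<dots> = (\<Sum>s\<le>Suc k. (- l a) ^ s * esym l S (Suc k - s))"
      using S(1) a by (rule esym_remove_expand)
    also have "\<dots> = (- l a) ^ Suc k + (\<Sum>s<Suc k. (- l a) ^ s * esym l S (Suc k - s))"
      using S by (simp add: esym_0 lessThan_Suc_atMost)
    finally have "(- l a) ^ Suc k = - (\<Sum>s<Suc k. (- l a) ^ s * esym l S (Suc k - s))"
      by (simp add: eq_neg_iff_add_eq_0)
    then have "(-1) ^ Suc k * (- l a) ^ Suc k
        = (\<Sum>s<Suc k. - ((-1) ^ Suc k * (- l a) ^ s * esym l S (Suc k - s)))"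
      by (simp only: sum_distrib_left sum_negf mult_minus_right mult.assoc)
    also have "\<dots> = (\<Sum>m<Suc k. d m * l a ^ m)"
      by (rule sum.cong[OF refl]) (simp add: d_def power_add power_minus[of "l a"] mult_ac)
    finally show ?thesis
      by (simp add: power_mult_distrib[symmetric] del: power_Suc)
  qed
  \<comment> \<open>Multiplication by \<open>l a\<close> shifts the coefficients by one; the
    overflowing term \<open>c k * l a ^ Suc k\<close> is rewritten by \<open>red\<close>.\<close>
  let ?c = "\<lambda>m. (if m = 0 then 0 else c (m - 1)) + c k * d m"
  have "range ?c \<subseteq> B"
    using c(1) d by (auto intro!: add_mem mult_mem zero_mem simp: image_subset_iff)
  moreover have "l a ^ Suc n = (\<Sum>m<card S. ?c m * l a ^ m)" if a: "a \<in> S" for a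
  proof -
    have "l a ^ Suc n = (\<Sum>m<Suc k. c m * l a ^ Suc m)"
      using c(2) a k by (simp add: sum_distrib_left distrib_left mult.left_commute)
    also have "\<dots> = (\<Sum>m<k. c m * l a ^ Suc m) + c k * (\<Sum>m<Suc k. d m * l a ^ m)"
      using red[OF a] by simp
    also have "(\<Sum>m<k. c m * l a ^ Suc m)
        = (\<Sum>m<Suc k. (if m = 0 then 0 else c (m - 1)) * l a ^ m)"
      by (subst sum.lessThan_Suc_shift) simp
    finally show ?thesis
      unfolding k by (simp only: sum_distrib_left distrib_right sum.distrib mult.assoc)
  qed
  ultimately show ?case by blast
qed

text \<open>Removing one index \<open>a\<close> from \<open>insert a J\<close> turns the sum over injections into a product of two
  such sums, minus the terms in which \<open>a\<close> collides with some \<open>j \<in> J\<close>. No division is needed.\<close>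

lemma injection_sum_mem:
  fixes S :: "'i set" and J :: "'j set" and u :: "'j \<Rightarrow> 'i \<Rightarrow> 'a"
  assumes S: "finite S"
    and G_mult: "\<And>u v. u \<in> G \<Longrightarrow> v \<in> G \<Longrightarrow> (\<lambda>i. u i * v i) \<in> G"
    and G_sum: "\<And>u. u \<in> G \<Longrightarrow> (\<Sum>i\<in>S. u i) \<in> B"
    and J: "finite J" and u: "\<And>j. j \<in> J \<Longrightarrow> u j \<in> G"
  shows "(\<Sum>\<phi> | \<phi> \<in> J \<rightarrow>\<^sub>E S \<and> inj_on \<phi> J. \<Prod>j\<in>J. u j (\<phi> j)) \<in> B"
  using J u
proof (induction J arbitrary: u rule: finite_induct)
  case empty
  have "{\<phi> :: 'j \<Rightarrow> 'i. \<phi> \<in> {} \<rightarrow>\<^sub>E S \<and> inj_on \<phi> {}} = {\<lambda>_. undefined}" by auto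
  then show ?case by (simp add: one_mem)
next
  case (insert a J)
  let ?I = "\<lambda>J. {\<phi>. \<phi> \<in> J \<rightarrow>\<^sub>E S \<and> inj_on \<phi> J}"
  let ?M = "\<lambda>u. \<Sum>\<phi>\<in>?I J. \<Prod>j\<in>J. u j (\<phi> j)"
  have fin: "finite (?I J)"
    using S insert(1) by (auto intro: finite_subset[OF _ finite_PiE[of J "\<lambda>_. S"]])
  have "(\<Sum>\<phi>\<in>?I (insert a J). \<Prod>j\<in>insert a J. u j (\<phi> j))
      = (\<Sum>(\<phi>, i)\<in>(SIGMA \<phi>:?I J. S - \<phi> ` J). u a i * (\<Prod>j\<in>J. u j (\<phi> j)))"
  \<comment> \<open>Resetting the value at \<open>a\<close> to \<open>undefined\<close> keeps the
    restricted injection extensional on \<open>J\<close>.\<close>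
  proof (rule sum.reindex_bij_witness[of _ "\<lambda>(\<phi>, i). \<phi>(a := i)" "\<lambda>\<phi>. (\<phi>(a := undefined), \<phi> a)"])
    fix \<phi> assume "\<phi> \<in> ?I (insert a J)"
    then have \<phi>: "\<phi> \<in> insert a J \<rightarrow>\<^sub>E S" "inj_on \<phi> (insert a J)" by auto
    show "(case (\<phi>(a := undefined), \<phi> a) of (\<phi>, i) \<Rightarrow> \<phi>(a := i)) = \<phi>" by simp
    have "\<phi>(a := undefined) \<in> J \<rightarrow>\<^sub>E S"
      using \<phi>(1) insert(2) by (auto simp: PiE_def Pi_def extensional_def)
    moreover have "inj_on (\<phi>(a := undefined)) J"
      using \<phi>(2) insert(2) by (auto simp: inj_on_def)
    moreover have "\<phi> a \<in> S - (\<phi>(a := undefined)) ` J"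
      using \<phi> insert(2) by (auto simp: inj_on_def)
    ultimately show "(\<phi>(a := undefined), \<phi> a) \<in> (SIGMA \<phi>:?I J. S - \<phi> ` J)" by auto
    show "(case (\<phi>(a := undefined), \<phi> a) of (\<phi>, i) \<Rightarrow> u a i * (\<Prod>j\<in>J. u j (\<phi> j)))
        = (\<Prod>j\<in>insert a J. u j (\<phi> j))"
      using insert(1,2) by (auto intro!: arg_cong2[where f = "(*)"] prod.cong)
  next
    fix x assume "x \<in> (SIGMA \<phi>:?I J. S - \<phi> ` J)"
    then obtain \<phi> i where x: "x = (\<phi>, i)" "\<phi> \<in> J \<rightarrow>\<^sub>E S" "inj_on \<phi> J" "i \<in> S" "i \<notin> \<phi> ` J" by auto
    show "(((case x of (\<phi>, i) \<Rightarrow> \<phi>(a := i))(a := undefined)), (case x of (\<phi>, i) \<Rightarrow> \<phi>(a := i)) a) = x"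
      using x insert(2) by (auto simp: fun_eq_iff PiE_def extensional_def)
    show "(case x of (\<phi>, i) \<Rightarrow> \<phi>(a := i)) \<in> ?I (insert a J)"
      using x insert(2) by (auto simp: inj_on_def PiE_def Pi_def extensional_def)
  qed
  also have "\<dots> = (\<Sum>\<phi>\<in>?I J. \<Sum>i\<in>S - \<phi> ` J. u a i * (\<Prod>j\<in>J. u j (\<phi> j)))"
    using S fin by (subst sum.Sigma) auto
  also have "\<dots> = (\<Sum>\<phi>\<in>?I J. (\<Sum>i\<in>S. u a i) * (\<Prod>j\<in>J. u j (\<phi> j))
      - (\<Sum>k\<in>J. \<Prod>j\<in>J. (u(k := \<lambda>i. u k i * u a i)) j (\<phi> j)))"
  proof (rule sum.cong[OF refl])
    fix \<phi> assume "\<phi> \<in> ?I J"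
    then have \<phi>: "\<phi> \<in> J \<rightarrow>\<^sub>E S" "inj_on \<phi> J" by auto
    have "(\<Sum>i\<in>S - \<phi> ` J. u a i) = (\<Sum>i\<in>S. u a i) - (\<Sum>k\<in>J. u a (\<phi> k))"
      using S \<phi> by (subst sum_diff) (auto simp: sum.reindex)
    then have "(\<Sum>i\<in>S - \<phi> ` J. u a i * (\<Prod>j\<in>J. u j (\<phi> j)))
        = (\<Sum>i\<in>S. u a i) * (\<Prod>j\<in>J. u j (\<phi> j)) - (\<Sum>k\<in>J. u a (\<phi> k) * (\<Prod>j\<in>J. u j (\<phi> j)))"
      by (simp only: sum_distrib_right[symmetric] left_diff_distrib)
    moreover have "u a (\<phi> k) * (\<Prod>j\<in>J. u j (\<phi> j)) = (\<Prod>j\<in>J. (u(k := \<lambda>i. u k i * u a i)) j (\<phi> j))"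
      if "k \<in> J" for k
      using insert(1) that by (simp add: prod.remove[of J k] mult_ac)
    ultimately show "(\<Sum>i\<in>S - \<phi> ` J. u a i * (\<Prod>j\<in>J. u j (\<phi> j))) = (\<Sum>i\<in>S. u a i) * (\<Prod>j\<in>J. u j (\<phi> j))
      - (\<Sum>k\<in>J. \<Prod>j\<in>J. (u(k := \<lambda>i. u k i * u a i)) j (\<phi> j))" by simp
  qed
  also have "\<dots> = (\<Sum>i\<in>S. u a i) * ?M u - (\<Sum>k\<in>J. ?M (u(k := \<lambda>i. u k i * u a i)))"
    by (simp only: sum_subtractf sum_distrib_left sum.swap[of _ J])
  also have "\<dots> \<in> B"
    using insert(4) by (intro diff_mem mult_mem sum_mem[of J] G_sum insert.IH) (auto intro: G_mult)
  finally show ?case .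
qed

end

subsection \<open>Polynomials in auxiliary variables\<close>

text \<open>In \<open>'n \<Rightarrow>\<^sub>0 ('m \<Rightarrow>\<^sub>0 'k)\<close>, the inner exponents \<open>'m\<close> are those of the auxiliary variables \<open>t\<close>: \<open>tmul d w\<close>
  is \<open>t\<^sup>dw\<close>, and \<open>coef d G\<close> is the coefficient of \<open>t\<^sup>d\<close>.\<close>

definition tmul :: "'m \<Rightarrow> ('n \<Rightarrow>\<^sub>0 'k::zero) \<Rightarrow> ('n \<Rightarrow>\<^sub>0 ('m \<Rightarrow>\<^sub>0 'k))" where
  "tmul d w = Poly_Mapping.map (Poly_Mapping.single d) w"

definition coef :: "'m \<Rightarrow> ('n \<Rightarrow>\<^sub>0 ('m \<Rightarrow>\<^sub>0 'k::zero)) \<Rightarrow> ('n \<Rightarrow>\<^sub>0 'k)" where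
  "coef d G = Poly_Mapping.map (\<lambda>c. Poly_Mapping.lookup c d) G"

lemma lookup_tmul: "Poly_Mapping.lookup (tmul d w) m = Poly_Mapping.single d (Poly_Mapping.lookup w m)"
  by (auto simp: tmul_def Poly_Mapping.map.rep_eq when_def)

lemma lookup_coef: "Poly_Mapping.lookup (coef d G) m = Poly_Mapping.lookup (Poly_Mapping.lookup G m) d"
  by (auto simp: coef_def Poly_Mapping.map.rep_eq when_def)

lemma tmul_zero [simp]: "tmul d 0 = 0"
  by (rule poly_mapping_eqI) (simp add: lookup_tmul)

lemma coef_zero [simp]: "coef d 0 = 0"
  by (rule poly_mapping_eqI) (simp add: lookup_coef)

lemma tmul_add: "tmul d (v + w) = tmul d v + tmul d w"
  by (rule poly_mapping_eqI) (simp add: lookup_tmul lookup_add single_add)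

lemma coef_add: "coef d (F + G) = coef d F + coef d G"
  by (rule poly_mapping_eqI) (simp add: lookup_coef lookup_add)

lemma tmul_sum: "tmul d (sum f I) = (\<Sum>i\<in>I. tmul d (f i))"
  by (induction I rule: infinite_finite_induct) (auto simp: tmul_add)

lemma coef_sum: "coef d (sum f I) = (\<Sum>i\<in>I. coef d (f i))"
  by (induction I rule: infinite_finite_induct) (auto simp: coef_add)

lemma coef_uminus: "coef d (- G) = - coef d (G :: 'n \<Rightarrow>\<^sub>0 ('m \<Rightarrow>\<^sub>0 'k::ab_group_add))"
  by (rule poly_mapping_eqI) (simp add: lookup_coef)

lemma tmul_single: "tmul d (Poly_Mapping.single n a) = Poly_Mapping.single n (Poly_Mapping.single d a)"
  by (rule poly_mapping_eqI) (auto simp: lookup_tmul lookup_single when_def)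

lemma coef_tmul: "coef d (tmul e w) = (if d = e then w else 0)"
  by (rule poly_mapping_eqI) (auto simp: lookup_coef lookup_tmul lookup_single when_def)

lemma poly_mapping_sum_single:
  "(\<Sum>k\<in>Poly_Mapping.keys f. Poly_Mapping.single k (Poly_Mapping.lookup f k)) = f"
  by (rule poly_mapping_eqI)
     (auto simp: lookup_sum lookup_single when_def in_keys_iff if_distrib sum.delta' cong: if_cong)

lemma tmul_mult:
  fixes v w :: "'n::comm_monoid_add \<Rightarrow>\<^sub>0 'k::comm_ring_1" and d e :: "'m::comm_monoid_add"
  shows "tmul d v * tmul e w = tmul (d + e) (v * w)"
proof -
  let ?s = Poly_Mapping.single and ?l = Poly_Mapping.lookup and ?k = Poly_Mapping.keys
  have "tmul d (\<Sum>a\<in>?k v. ?s a (?l v a)) * tmul e (\<Sum>b\<in>?k w. ?s b (?l w b))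
      = tmul (d + e) ((\<Sum>a\<in>?k v. ?s a (?l v a)) * (\<Sum>b\<in>?k w. ?s b (?l w b)))"
    by (simp only: sum_product tmul_sum tmul_single mult_single)
  then show ?thesis by (simp only: poly_mapping_sum_single)
qed

lemma tmul_one: "tmul 0 1 = 1"
  by (rule poly_mapping_eqI) (simp add: lookup_tmul lookup_one when_def)

lemma tmul_power:
  fixes w :: "'n::comm_monoid_add \<Rightarrow>\<^sub>0 'k::comm_ring_1"
  shows "tmul (Poly_Mapping.single j a) w ^ n = tmul (Poly_Mapping.single j (n * a)) (w ^ n)"
  by (induction n) (auto simp: tmul_mult tmul_one single_add[symmetric])

lemma tmul_zero_power:
  fixes w :: "'n::comm_monoid_add \<Rightarrow>\<^sub>0 'k::comm_ring_1"
  shows "tmul (0 :: 'm::comm_monoid_add) w ^ n = tmul 0 (w ^ n)"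
  by (induction n) (auto simp: tmul_mult tmul_one)

text \<open>Reduces products to single terms, where \<open>tmul_mult\<close> applies. Vanishing off
  \<open>E\<close> allows a coefficient to be picked out without knowing whether its exponent lies
  in \<open>E\<close>.\<close>

lemma tmul_expansion:
  "\<exists>E. finite E \<and> (\<forall>e. e \<notin> E \<longrightarrow> coef e G = 0) \<and> G = (\<Sum>e\<in>E. tmul e (coef e G))"
proof (intro exI conjI)
  let ?E = "\<Union>m\<in>Poly_Mapping.keys G. Poly_Mapping.keys (Poly_Mapping.lookup G m)"
  show fin: "finite ?E" by auto
  show out: "\<forall>e. e \<notin> ?E \<longrightarrow> coef e G = 0"
  proof (intro allI impI poly_mapping_eqI)
    fix e m assume "e \<notin> ?E"
    then show "Poly_Mapping.lookup (coef e G) m = Poly_Mapping.lookup 0 m"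
      by (cases "m \<in> Poly_Mapping.keys G") (auto simp: lookup_coef in_keys_iff)
  qed
  show "G = (\<Sum>e\<in>?E. tmul e (coef e G))"
  proof (intro poly_mapping_eqI)
    fix m d
    have "Poly_Mapping.lookup (Poly_Mapping.lookup (\<Sum>e\<in>?E. tmul e (coef e G)) m) d
        = (\<Sum>e\<in>?E. if e = d then Poly_Mapping.lookup (Poly_Mapping.lookup G m) d else 0)"
      by (simp add: lookup_sum lookup_tmul lookup_coef lookup_single when_def)
    also have "\<dots> = Poly_Mapping.lookup (Poly_Mapping.lookup G m) d"
    proof (cases "d \<in> ?E")
      case False
      then have "coef d G = 0" using out by blast
      then have "Poly_Mapping.lookup (Poly_Mapping.lookup G m) d = 0"
        by (metis lookup_coef lookup_zero)
      then show ?thesis by simp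
    qed (use fin in \<open>simp add: sum.delta'\<close>)
    finally show "Poly_Mapping.lookup (Poly_Mapping.lookup G m) d
        = Poly_Mapping.lookup (Poly_Mapping.lookup (\<Sum>e\<in>?E. tmul e (coef e G)) m) d" by simp
  qed
qed

context
  fixes w :: "'n::comm_monoid_add \<Rightarrow>\<^sub>0 'k::comm_ring_1"
    and G :: "'n \<Rightarrow>\<^sub>0 ('m::cancel_comm_monoid_add \<Rightarrow>\<^sub>0 'k)"
begin

text \<open>Exponents cancel, so only the term of \<open>G\<close> at \<open>e\<close> reaches
  \<open>d + e\<close>.\<close>

lemma coef_tmul_mult: "coef (d + e) (tmul d w * G) = w * coef e G"
proof -
  obtain E where E: "finite E" "\<And>e. e \<notin> E \<Longrightarrow> coef e G = 0" "G = (\<Sum>e\<in>E. tmul e (coef e G))"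
    using tmul_expansion[of G] by blast
  have "coef (d + e) (tmul d w * G) = coef (d + e) (\<Sum>f\<in>E. tmul d w * tmul f (coef f G))"
    by (subst E(3)) (simp add: sum_distrib_left)
  also have "\<dots> = (\<Sum>f\<in>E. if e = f then w * coef f G else 0)"
    by (simp add: coef_sum tmul_mult coef_tmul)
  also have "\<dots> = w * coef e G"
    using E(1,2) by (cases "e \<in> E") (auto simp: sum.delta)
  finally show ?thesis .
qed

lemma coef_tmul_mult_eq_0:
  assumes "\<And>e. d' \<noteq> d + e"
  shows "coef d' (tmul d w * G) = 0"
proof -
  obtain E where E: "G = (\<Sum>e\<in>E. tmul e (coef e G))"
    using tmul_expansion[of G] by blast
  have "coef d' (tmul d w * G) = coef d' (\<Sum>f\<in>E. tmul d w * tmul f (coef f G))"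
    by (subst E) (simp add: sum_distrib_left)
  also have "\<dots> = 0"
    using assms by (simp add: coef_sum tmul_mult coef_tmul)
  finally show ?thesis .
qed

end

lemma coef_one:
  "coef d (1 :: 'n::zero \<Rightarrow>\<^sub>0 ('m::zero \<Rightarrow>\<^sub>0 'k::comm_ring_1)) = (if d = 0 then 1 else 0)"
  by (rule poly_mapping_eqI) (simp add: lookup_coef lookup_one when_def)

text \<open>Makes \<open>freshmans_dream_sum\<close> available in polynomial rings, also iterated
  ones.\<close>

lemma CHAR_poly_mapping:
  "CHAR('n::monoid_add \<Rightarrow>\<^sub>0 'k::semiring_1) = CHAR('k)"
proof (rule CHAR_eqI)
  have of_nat: "(of_nat n :: 'n \<Rightarrow>\<^sub>0 'k) = Poly_Mapping.single 0 (of_nat n)" for n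
    by simp
  show "of_nat CHAR('k) = (0 :: 'n \<Rightarrow>\<^sub>0 'k)"
    by (simp only: of_nat of_nat_CHAR single_zero)
  show "CHAR('k) dvd n" if "of_nat n = (0 :: 'n \<Rightarrow>\<^sub>0 'k)" for n
    using arg_cong[OF that, of "\<lambda>f. Poly_Mapping.lookup f 0"]
    by (simp add: lookup_of_nat of_nat_eq_0_iff_char_dvd)
qed


text \<open>This set is \<open>W[t]\<close>; being a subring, it admits \<open>power_sum_mem\<close>
  and \<open>power_reduction\<close> for generic linear forms.\<close>

lemma unital_subring_coef:
  fixes W :: "('n::comm_monoid_add \<Rightarrow>\<^sub>0 'k::comm_ring_1) set"
  assumes W: "unital_subring W"
  shows "unital_subring {F :: 'n \<Rightarrow>\<^sub>0 ('m::cancel_comm_monoid_add \<Rightarrow>\<^sub>0 'k). \<forall>d. coef d F \<in> W}"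
proof -
  interpret unital_subring W by fact
  show ?thesis
  proof
    fix F G :: "'n \<Rightarrow>\<^sub>0 ('m \<Rightarrow>\<^sub>0 'k)"
    assume F: "F \<in> {F. \<forall>d. coef d F \<in> W}" and G: "G \<in> {F. \<forall>d. coef d F \<in> W}"
    obtain E where E: "F = (\<Sum>e\<in>E. tmul e (coef e F))"
      using tmul_expansion[of F] by blast
    have "coef d (F * G) \<in> W" for d
    proof -
      have "coef d (tmul e (coef e F) * G) \<in> W" for e
        by (cases "\<exists>f. d = e + f")
           (use F G in \<open>auto simp: coef_tmul_mult coef_tmul_mult_eq_0 intro!: mult_mem zero_mem\<close>)
      moreover have "coef d (F * G) = (\<Sum>e\<in>E. coef d (tmul e (coef e F) * G))"
        by (subst E) (simp add: sum_distrib_right coef_sum)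
      ultimately show ?thesis by (simp add: sum_mem)
    qed
    then show "F * G \<in> {F. \<forall>d. coef d F \<in> W}" by blast
  qed (auto simp: coef_add coef_uminus coef_one intro: add_mem uminus_mem one_mem zero_mem)
qed

subsection \<open>Power sums of Frobenius powers\<close>

text \<open>Exponents of the auxiliary variables: there is one for every \<open>j \<noteq> 1\<close>, and the variable for
  \<open>j = 1\<close> is set to \<open>1\<close>.\<close>

definition texp :: "nat \<Rightarrow> nat \<Rightarrow> (nat \<Rightarrow>\<^sub>0 nat)" where
  "texp j n = (if j = 1 then 0 else Poly_Mapping.single j n)"

lemma lookup_texp: "Poly_Mapping.lookup (texp j n) l = (if j \<noteq> 1 \<and> l = j then n else 0)"
  by (simp add: texp_def lookup_single when_def)

lemma texp_0 [simp]: "texp j 0 = 0"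
  by (simp add: texp_def)

lemma texp_add: "texp j (m + n) = texp j m + texp j n"
  by (simp add: texp_def single_add)

text \<open>For \<open>x = mvar i\<close> this is the form \<open>L_i\<close> of the proof idea, cut
  off after \<open>N\<close> variables.\<close>

definition generic_form ::
    "nat \<Rightarrow> (nat \<Rightarrow> ('n::comm_monoid_add \<Rightarrow>\<^sub>0 'k::comm_ring_1)) \<Rightarrow> ('n \<Rightarrow>\<^sub>0 ((nat \<Rightarrow>\<^sub>0 nat) \<Rightarrow>\<^sub>0 'k))" where
  "generic_form N x = (\<Sum>j\<in>{1..N}. tmul (texp j 1) (x j))"

text \<open>The bound is on the degree in each auxiliary variable separately, not on the total
  degree.\<close>

definition tdeg_le ::
    "nat \<Rightarrow> ('n \<Rightarrow>\<^sub>0 ((nat \<Rightarrow>\<^sub>0 nat) \<Rightarrow>\<^sub>0 'k::zero)) \<Rightarrow> bool" where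
  "tdeg_le n G \<longleftrightarrow> (\<forall>d j. Poly_Mapping.lookup d j > n \<longrightarrow> coef d G = 0)"

lemma tdeg_le_one: "tdeg_le 0 (1 :: 'n::comm_monoid_add \<Rightarrow>\<^sub>0 ((nat \<Rightarrow>\<^sub>0 nat) \<Rightarrow>\<^sub>0 'k::comm_ring_1))"
  by (auto simp: tdeg_le_def coef_one)

lemma tdeg_le_generic_form_mult:
  assumes "tdeg_le n G"
  shows "tdeg_le (Suc n) (generic_form N x * G)"
  unfolding tdeg_le_def
proof (intro allI impI)
  fix d :: "nat \<Rightarrow>\<^sub>0 nat" and j assume d: "Poly_Mapping.lookup d j > Suc n"
  have "coef d (tmul (texp l 1) (x l) * G) = 0" for l
  proof (cases "\<exists>e. d = texp l 1 + e")
    case True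
    then obtain e where e: "d = texp l 1 + e" by blast
    then have "Poly_Mapping.lookup e j > n"
      using d by (auto simp: lookup_add lookup_texp split: if_splits)
    then show ?thesis using assms by (auto simp: e coef_tmul_mult tdeg_le_def)
  qed (auto intro: coef_tmul_mult_eq_0)
  then show "coef d (generic_form N x * G) = 0"
    by (simp add: generic_form_def sum_distrib_right coef_sum)
qed

lemma tdeg_le_power: "tdeg_le m (generic_form N x ^ m)"
  by (induction m) (auto intro: tdeg_le_one tdeg_le_generic_form_mult)

lemma tdeg_le_prod: "finite I \<Longrightarrow> tdeg_le (card I) (\<Prod>i\<in>I. generic_form N (x i))"
  by (induction I rule: finite_induct) (auto intro: tdeg_le_one tdeg_le_generic_form_mult)

text \<open>The exponent \<open>d + texp j q\<close> singles out the summand \<open>l = j\<close>.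
  For other \<open>l\<close> different from 1, its entry at \<open>l\<close> is below
  \<open>q\<close>. The summand \<open>l = 1\<close> carries no auxiliary variable, so there the
  exponent at \<open>j\<close> exceeds the degree of \<open>G\<close>; for \<open>j = 1\<close> this
  case does not arise, hence the premise in \<open>dj\<close>.\<close>

lemma coef_isolate:
  fixes z :: "nat \<Rightarrow> ('n::comm_monoid_add \<Rightarrow>\<^sub>0 'k::comm_ring_1)"
  assumes G: "tdeg_le m G" and j: "j \<in> {1..N}"
    and d: "\<And>l. l \<noteq> j \<Longrightarrow> Poly_Mapping.lookup d l < q"
    and dj: "j \<noteq> 1 \<Longrightarrow> m < Poly_Mapping.lookup d j + q"
  shows "coef (d + texp j q) ((\<Sum>l\<in>{1..N}. tmul (texp l q) (z l)) * G) = z j * coef d G"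
proof -
  have "coef (d + texp j q) (tmul (texp l q) (z l) * G) = 0" if l: "l \<noteq> j" for l
  proof (cases "l = 1")
    case True
    then have "j \<noteq> 1" using l by simp
    then have "m < Poly_Mapping.lookup (d + texp j q) j"
      using dj by (simp add: lookup_add lookup_texp)
    then have "coef (d + texp j q) G = 0"
      using G by (auto simp: tdeg_le_def)
    then show ?thesis
      using coef_tmul_mult[of 0 "d + texp j q" "z l" G] True by (simp add: texp_def)
  next
    case False
    have "d + texp j q \<noteq> texp l q + e" for e
    proof
      assume "d + texp j q = texp l q + e"
      then have "Poly_Mapping.lookup (d + texp j q) l = Poly_Mapping.lookup (texp l q + e) l" by simp
      then show False using d[OF l] l False by (simp add: lookup_add lookup_texp)
    qed
    then show ?thesis by (rule coef_tmul_mult_eq_0)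
  qed
  then have "coef (d + texp j q) ((\<Sum>l\<in>{1..N}. tmul (texp l q) (z l)) * G)
      = (\<Sum>l\<in>{1..N}. if l = j then coef (d + texp j q) (tmul (texp l q) (z l) * G) else 0)"
    unfolding sum_distrib_right coef_sum by (intro sum.cong refl) auto
  also have "\<dots> = coef (texp j q + d) (tmul (texp j q) (z j) * G)"
    using j by (simp add: add.commute)
  finally show ?thesis by (simp add: coef_tmul_mult)
qed

text \<open>At the largest power of the \<open>j\<close>-th auxiliary variable every factor must
  contribute \<open>x i j\<close>; for \<open>j = 1\<close> this is the constant
  coefficient.\<close>

lemma coef_prod_generic_form:
  assumes "finite I" and j: "j \<in> {1..N}"
  shows "coef (texp j (card I)) (\<Prod>i\<in>I. generic_form N (x i)) = (\<Prod>i\<in>I. x i j)"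
  using assms(1)
proof (induction I rule: finite_induct)
  case empty
  then show ?case by (simp add: coef_one)
next
  case (insert i I)
  have "coef (texp j (card I) + texp j 1) ((\<Sum>l\<in>{1..N}. tmul (texp l 1) (x i l)) * (\<Prod>i\<in>I. generic_form N (x i)))
      = x i j * coef (texp j (card I)) (\<Prod>i\<in>I. generic_form N (x i))"
    using insert(1) j by (intro coef_isolate[OF tdeg_le_prod]) (auto simp: lookup_texp)
  then show ?case
    using insert by (simp add: generic_form_def texp_add[symmetric])
qed

lemma generic_form_power_CHAR:
  fixes x :: "nat \<Rightarrow> ('n::comm_monoid_add \<Rightarrow>\<^sub>0 'k::comm_ring_1)"
  assumes "CHAR('k) = p" "prime p"
  shows "generic_form N x ^ p = (\<Sum>j\<in>{1..N}. tmul (texp j p) (x j ^ p))"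
proof -
  have CHAR: "CHAR('n \<Rightarrow>\<^sub>0 ((nat \<Rightarrow>\<^sub>0 nat) \<Rightarrow>\<^sub>0 'k)) = p"
    using assms by (simp add: CHAR_poly_mapping)
  have "generic_form N x ^ p = (\<Sum>j\<in>{1..N}. tmul (texp j 1) (x j) ^ p)"
    unfolding generic_form_def
    by (rule freshmans_dream_sum) (simp_all add: CHAR assms)
  also have "\<dots> = (\<Sum>j\<in>{1..N}. tmul (texp j p) (x j ^ p))"
    by (intro sum.cong refl) (simp add: texp_def tmul_power tmul_zero_power)
  finally show ?thesis .
qed

text \<open>All that the argument takes from \<open>GL\<close>-stability is \<open>esym_mem\<close>;
  the group action stays out of sight until the locale is interpreted.\<close>

locale polarized = unital_subring W
  for W :: "('n::comm_monoid_add \<Rightarrow>\<^sub>0 'k::comm_ring_1) set" +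
  fixes S :: "'i set" and p N :: nat and x :: "'i \<Rightarrow> nat \<Rightarrow> ('n \<Rightarrow>\<^sub>0 'k)"
  assumes S: "finite S" "card S = p"
    and p: "prime p" "CHAR('k) = p"
    and esym_mem: "coef d (esym (\<lambda>i. generic_form N (x i)) S r) \<in> W"
begin

abbreviation L where "L i \<equiv> generic_form N (x i)"

text \<open>The span \<open>U\<close> of the proof idea above.\<close>

inductive_set low :: "('i \<Rightarrow> ('n \<Rightarrow>\<^sub>0 'k)) set" where
  coef: "m < p \<Longrightarrow> (\<lambda>i. coef d (L i ^ m)) \<in> low"
| zero: "(\<lambda>i. 0) \<in> low"
| add: "u \<in> low \<Longrightarrow> v \<in> low \<Longrightarrow> (\<lambda>i. u i + v i) \<in> low"
| scale: "w \<in> W \<Longrightarrow> u \<in> low \<Longrightarrow> (\<lambda>i. w * u i) \<in> low"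
| eq_on: "u \<in> low \<Longrightarrow> (\<And>i. i \<in> S \<Longrightarrow> v i = u i) \<Longrightarrow> v \<in> low"

lemma low_sum: "(\<And>a. a \<in> A \<Longrightarrow> u a \<in> low) \<Longrightarrow> (\<lambda>i. \<Sum>a\<in>A. u a i) \<in> low"
  by (induction A rule: infinite_finite_induct) (auto intro: low.zero low.add)

text \<open>For the generators this is Newton's identities in \<open>W[t]\<close>; the other rules
  preserve it because \<open>W\<close> is a subring.\<close>

lemma low_sum_mem: "u \<in> low \<Longrightarrow> (\<Sum>i\<in>S. u i) \<in> W"
proof (induction rule: low.induct)
  case (coef m d)
  interpret T: unital_subring "{F :: 'n \<Rightarrow>\<^sub>0 ((nat \<Rightarrow>\<^sub>0 nat) \<Rightarrow>\<^sub>0 'k). \<forall>d. coef d F \<in> W}"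
    by (rule unital_subring_coef) (rule unital_subring_axioms)
  have "(\<Sum>i\<in>S. L i ^ m) \<in> {F. \<forall>d. coef d F \<in> W}"
    using S(1) by (rule T.power_sum_mem) (use esym_mem in auto)
  then show ?case by (simp add: coef_sum)
next
  case (scale w u)
  then show ?case by (simp add: sum_distrib_left[symmetric] mult_mem)
qed (auto simp: sum.distrib zero_mem add_mem)

text \<open>By \<open>power_reduction\<close> over \<open>W[t]\<close>, \<open>L i ^ n\<close> is a
  combination of powers below \<open>p\<close> whose coefficients do not depend on
  \<open>i\<close>.\<close>

lemma low_coef_power: "(\<lambda>i. coef d (L i ^ n)) \<in> low"
proof -
  interpret T: unital_subring "{F :: 'n \<Rightarrow>\<^sub>0 ((nat \<Rightarrow>\<^sub>0 nat) \<Rightarrow>\<^sub>0 'k). \<forall>d. coef d F \<in> W}"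
    by (rule unital_subring_coef) (rule unital_subring_axioms)
  have "S \<noteq> {}" using S p by (auto dest: prime_gt_0_nat)
  then obtain c where c: "range c \<subseteq> {F. \<forall>d. coef d F \<in> W}"
      "\<forall>i\<in>S. L i ^ n = (\<Sum>m<card S. c m * L i ^ m)"
    using T.power_reduction[OF S(1), of L n] esym_mem by auto
  have "(\<lambda>i. coef d (c m * L i ^ m)) \<in> low" if m: "m < p" for m
  proof -
    \<comment> \<open>\<open>low\<close> can be scaled by elements of \<open>W\<close> only, so
      \<open>c m\<close> from \<open>W[t]\<close> is split into its coefficients.\<close>
    obtain E where E: "c m = (\<Sum>e\<in>E. tmul e (coef e (c m)))"
      using tmul_expansion[of "c m"] by blast
    have "(\<lambda>i. coef d (tmul e (coef e (c m)) * L i ^ m)) \<in> low" for e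
    proof (cases "\<exists>f. d = e + f")
      case True
      then obtain f where f: "d = e + f" by blast
      have "coef e (c m) \<in> W" using c(1) by (auto simp: image_subset_iff)
      then show ?thesis
        unfolding f coef_tmul_mult by (intro low.scale low.coef m)
    next
      case False
      then have "coef d (tmul e (coef e (c m)) * L i ^ m) = 0" for i
        by (intro coef_tmul_mult_eq_0) auto
      then show ?thesis by (simp add: low.zero)
    qed
    then have "(\<lambda>i. \<Sum>e\<in>E. coef d (tmul e (coef e (c m)) * L i ^ m)) \<in> low"
      by (rule low_sum)
    moreover have "coef d (c m * L i ^ m) = (\<Sum>e\<in>E. coef d (tmul e (coef e (c m)) * L i ^ m))" for i
      by (subst E) (simp add: sum_distrib_right coef_sum)
    ultimately show ?thesis by simp
  qed
  then have "(\<lambda>i. \<Sum>m<p. coef d (c m * L i ^ m)) \<in> low"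
    by (intro low_sum) auto
  then show ?thesis
    by (rule low.eq_on) (use c(2) S in \<open>simp add: coef_sum\<close>)
qed

text \<open>By the Frobenius formula for \<open>L i ^ p\<close>, the coefficient of
  \<open>L i ^ (p + m)\<close> at \<open>d + texp j p\<close> is \<open>x i j ^ p\<close> times that
  of \<open>L i ^ m\<close> at \<open>d\<close>; \<open>low_coef_power\<close> shows that it belongs
  to \<open>low\<close>.\<close>

lemma low_power_mult:
  assumes j: "j \<in> {1..N}"
  shows "u \<in> low \<Longrightarrow> (\<lambda>i. x i j ^ p * u i) \<in> low"
proof (induction rule: low.induct)
  case (coef m d)
  show ?case
  \<comment> \<open>An exponent above \<open>m\<close> makes the generator zero; otherwise all
    exponents are below \<open>p\<close>, as \<open>coef_isolate\<close> needs.\<close>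
  proof (cases "\<forall>l. Poly_Mapping.lookup d l \<le> m")
    case True
    then have lt: "Poly_Mapping.lookup d l < p" for l
      using coef le_less_trans by blast
    have "coef (d + texp j p) (L i ^ (p + m)) = x i j ^ p * coef d (L i ^ m)" for i
      unfolding power_add generic_form_power_CHAR[OF p(2,1)]
      by (rule coef_isolate[OF tdeg_le_power j]) (use lt coef in auto)
    then show ?thesis
      using low_coef_power[of "d + texp j p" "p + m"] by simp
  next
    case False
    then obtain l where "Poly_Mapping.lookup d l > m" by (auto simp: not_le)
    then have "coef d (L i ^ m) = 0" for i
      using tdeg_le_power[of m N "x i"] by (auto simp: tdeg_le_def)
    then show ?thesis by (simp add: low.zero)
  qed
next
  case (add u v)
  then show ?case using low.add by (simp add: distrib_left)
next
  case (scale w u)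
  then show ?case using low.scale[OF scale(1,3)] by (simp add: mult.left_commute)
next
  case (eq_on u v)
  then show ?case by (auto intro: low.eq_on)
qed (auto intro: low.zero)

text \<open>The constant family 1 comes from \<open>L i ^ 0\<close>, and
  \<open>low_power_mult\<close> builds up the monomial inside \<open>low\<close> factor by
  factor.\<close>

lemma frobenius_monomial_sum_mem: "(\<Sum>i\<in>S. \<Prod>j\<in>{1..N}. (x i j ^ p) ^ a j) \<in> W"
proof -
  have one: "(\<lambda>i. 1) \<in> low"
    using low.coef[of 0 0] p(1) by (simp add: coef_one prime_gt_0_nat)
  have pow: "(\<lambda>i. (x i j ^ p) ^ n * u i) \<in> low" if "u \<in> low" "j \<in> {1..N}" for u j n
    by (induction n) (use that low_power_mult in \<open>auto simp: mult.assoc\<close>)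
  have "(\<lambda>i. \<Prod>j\<in>J. (x i j ^ p) ^ a j) \<in> low" if "finite J" "J \<subseteq> {1..N}" for J
    using that by (induction J rule: finite_induct) (auto intro: one pow)
  then show ?thesis by (intro low_sum_mem) auto
qed

text \<open>The top elementary symmetric function is the product of all \<open>L i\<close>, and the
  norm of column \<open>j\<close> is its coefficient at \<open>texp j p\<close>.\<close>

lemma norm_mem: "j \<in> {1..N} \<Longrightarrow> (\<Prod>i\<in>S. x i j) \<in> W"
  using coef_prod_generic_form[OF S(1), of j N x] esym_mem[of "texp j p" p] esym_card[OF S(1), of L] S(2)
  by simp

lemma frobenius_symmetrized_mem:
  "(\<Sum>\<sigma> | \<sigma> permutes S. \<Prod>i\<in>S. \<Prod>j\<in>{1..N}. (x (\<sigma> i) j ^ p) ^ a i j) \<in> W"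
proof -
  define G where "G = range (\<lambda>a i. \<Prod>j\<in>{1..N}. (x i j ^ p) ^ a j)"
  have "(\<Sum>\<phi> | \<phi> \<in> S \<rightarrow>\<^sub>E S \<and> inj_on \<phi> S. \<Prod>i\<in>S. \<Prod>j\<in>{1..N}. (x (\<phi> i) j ^ p) ^ a i j) \<in> W"
  proof (rule injection_sum_mem[where G = G])
    fix u v assume "u \<in> G" "v \<in> G"
    then obtain a b where "u = (\<lambda>i. \<Prod>j\<in>{1..N}. (x i j ^ p) ^ a j)"
        "v = (\<lambda>i. \<Prod>j\<in>{1..N}. (x i j ^ p) ^ b j)" by (auto simp: G_def)
    then have "(\<lambda>i. u i * v i) = (\<lambda>i. \<Prod>j\<in>{1..N}. (x i j ^ p) ^ (a j + b j))"
      by (simp add: prod.distrib power_add)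
    then show "(\<lambda>i. u i * v i) \<in> G" by (auto simp: G_def)
  qed (use S(1) frobenius_monomial_sum_mem in \<open>auto simp: G_def\<close>)
  also have "(\<Sum>\<phi> | \<phi> \<in> S \<rightarrow>\<^sub>E S \<and> inj_on \<phi> S. \<Prod>i\<in>S. \<Prod>j\<in>{1..N}. (x (\<phi> i) j ^ p) ^ a i j)
      = (\<Sum>\<sigma> | \<sigma> permutes S. \<Prod>i\<in>S. \<Prod>j\<in>{1..N}. (x (\<sigma> i) j ^ p) ^ a i j)"
  \<comment> \<open>An injection of the finite set \<open>S\<close> into itself is a permutation;
    only the values off \<open>S\<close> differ, \<open>undefined\<close> against the
    identity.\<close>
  proof (rule sum.reindex_bij_witness[of _ "\<lambda>\<sigma>. restrict \<sigma> S" "\<lambda>\<phi> i. if i \<in> S then \<phi> i else i"])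
    fix \<phi> assume \<phi>: "\<phi> \<in> {\<phi>. \<phi> \<in> S \<rightarrow>\<^sub>E S \<and> inj_on \<phi> S}"
    then have "\<phi> ` S \<subseteq> S" "inj_on \<phi> S" by auto
    then have "bij_betw \<phi> S S"
      using S(1) by (simp add: bij_betw_def endo_inj_surj)
    then have "bij_betw (\<lambda>i. if i \<in> S then \<phi> i else i) S S"
      by (rule bij_betw_cong[THEN iffD1, rotated]) simp
    then show "(\<lambda>i. if i \<in> S then \<phi> i else i) \<in> {\<sigma>. \<sigma> permutes S}"
      by (simp add: bij_imp_permutes)
    show "restrict (\<lambda>i. if i \<in> S then \<phi> i else i) S = \<phi>"
      using \<phi> by (auto simp: fun_eq_iff PiE_def extensional_def)
  next
    fix \<sigma> assume "\<sigma> \<in> {\<sigma>. \<sigma> permutes S}"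
    then have \<sigma>: "\<sigma> permutes S" by simp
    show "(\<lambda>i. if i \<in> S then restrict \<sigma> S i else i) = \<sigma>"
      using \<sigma> by (auto simp: fun_eq_iff permutes_not_in)
    show "restrict \<sigma> S \<in> {\<phi>. \<phi> \<in> S \<rightarrow>\<^sub>E S \<and> inj_on \<phi> S}"
      using \<sigma> by (auto simp: permutes_in_image inj_on_def dest: permutes_inj[THEN injD])
  qed (auto intro!: prod.cong)
  finally show ?thesis .
qed

end

subsection \<open>The group action over a polynomial ring\<close>

lemma ring_of_type_algebra_simps:
  "carrier ring_of_type_algebra = UNIV"
  "x \<otimes>\<^bsub>ring_of_type_algebra\<^esub> y = x * y"
  "x \<oplus>\<^bsub>ring_of_type_algebra\<^esub> y = x + y"
  "\<one>\<^bsub>ring_of_type_algebra\<^esub> = 1"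
  "\<zero>\<^bsub>ring_of_type_algebra\<^esub> = 0"
  by (simp_all add: ring_of_type_algebra_def)

lemma finsum_ring_of_type_algebra:
  fixes f :: "'i \<Rightarrow> 'r::comm_ring_1"
  assumes "finite I"
  shows "finsum ring_of_type_algebra f I = sum f I"
proof -
  interpret cring "ring_of_type_algebra :: 'r ring" by (rule cring_from_type_algebra)
  show ?thesis
    using assms by (induction I rule: finite_induct) (auto simp: ring_of_type_algebra_simps)
qed

text \<open>Counterpart of \<open>R_ring\<close> over any commutative coefficient ring, as needed
  for coefficients in \<open>k[t]\<close>.\<close>

definition poly_over :: "(nat \<times> nat) set \<Rightarrow> (monom \<Rightarrow>\<^sub>0 'r::comm_ring_1) set" where
  "poly_over V = {F. \<forall>m\<in>Poly_Mapping.keys F. Poly_Mapping.keys m \<subseteq> V}"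

lemma poly_over_zero: "0 \<in> poly_over V"
  by (simp add: poly_over_def)

lemma poly_over_single: "Poly_Mapping.keys m \<subseteq> V \<Longrightarrow> Poly_Mapping.single m c \<in> poly_over V"
  by (auto simp: poly_over_def split: if_splits)

lemma poly_over_add: "F \<in> poly_over V \<Longrightarrow> G \<in> poly_over V \<Longrightarrow> F + G \<in> poly_over V"
  by (auto simp: poly_over_def dest!: set_mp[OF keys_add])

lemma poly_over_mult: "F \<in> poly_over V \<Longrightarrow> G \<in> poly_over V \<Longrightarrow> F * G \<in> poly_over V"
  by (fastforce simp: poly_over_def dest!: set_mp[OF keys_mult] dest: set_mp[OF keys_add])

lemma poly_over_one: "1 \<in> poly_over V"
  using poly_over_single[of 0 V 1] by simp

lemma poly_over_sum: "(\<And>i. i \<in> I \<Longrightarrow> F i \<in> poly_over V) \<Longrightarrow> sum F I \<in> poly_over V"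
  by (induction I rule: infinite_finite_induct) (auto intro: poly_over_zero poly_over_add)

lemma poly_over_prod: "(\<And>i. i \<in> I \<Longrightarrow> F i \<in> poly_over V) \<Longrightarrow> prod F I \<in> poly_over V"
  by (induction I rule: infinite_finite_induct) (auto intro: poly_over_one poly_over_mult)

lemma poly_over_power: "F \<in> poly_over V \<Longrightarrow> F ^ n \<in> poly_over V"
  by (induction n) (auto intro: poly_over_one poly_over_mult)

text \<open>Each summand is bounded by \<open>m\<close>, hence determined by its values on the keys
  of \<open>m\<close>. The product in \<open>mpoly_ring\<close> is a \<open>finsum\<close> over this
  set, and an infinite \<open>finsum\<close> would be zero by convention.\<close>

lemma finite_sum_decompositions: "finite {(a, b). a + b = (m :: 'x \<Rightarrow>\<^sub>0 nat)}"
proof -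
  let ?A = "{a. \<forall>k. Poly_Mapping.lookup a k \<le> Poly_Mapping.lookup m k}"
  have inj: "inj_on (\<lambda>a. restrict (Poly_Mapping.lookup a) (Poly_Mapping.keys m)) ?A"
  proof (rule inj_onI, rule poly_mapping_eqI)
    fix a b k
    assume a: "a \<in> ?A" and b: "b \<in> ?A" and eq: "restrict (Poly_Mapping.lookup a) (Poly_Mapping.keys m)
      = restrict (Poly_Mapping.lookup b) (Poly_Mapping.keys m)"
    show "Poly_Mapping.lookup a k = Poly_Mapping.lookup b k"
    proof (cases "k \<in> Poly_Mapping.keys m")
      case True
      then show ?thesis using fun_cong[OF eq, of k] by simp
    next
      case False
      then have "Poly_Mapping.lookup m k = 0" by (simp add: in_keys_iff)
      then show ?thesis using a b by (metis (mono_tags) le_zero_eq mem_Collect_eq)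
    qed
  qed
  have "(\<lambda>a. restrict (Poly_Mapping.lookup a) (Poly_Mapping.keys m)) ` ?A
      \<subseteq> (\<Pi>\<^sub>E k\<in>Poly_Mapping.keys m. {..Poly_Mapping.lookup m k})"
    by auto
  then have "finite ?A"
    by (rule inj_on_finite[OF inj]) (auto intro: finite_PiE)
  moreover have "{(a, b). a + b = m} \<subseteq> ?A \<times> ?A"
    by (auto simp: lookup_add)
  ultimately show ?thesis by (meson finite_SigmaI finite_subset)
qed

section \<open>Transport of \<open>mpoly_ring\<close> along \<open>Poly_Mapping.lookup\<close> to
  type-class arithmetic\<close>

context
  fixes V :: "(nat \<times> nat) set" and A :: "'r::comm_ring_1 ring" and M :: "(monom \<Rightarrow> 'r) ring"
  defines "A \<equiv> ring_of_type_algebra" and "M \<equiv> mpoly_ring V A"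
begin

lemma mpoly_ring_carrier: "carrier M = Poly_Mapping.lookup ` poly_over V"
proof
  show "carrier M \<subseteq> Poly_Mapping.lookup ` poly_over V"
  proof
    fix f assume "f \<in> carrier M"
    then have f: "finite {m. f m \<noteq> 0}" "\<And>m. f m \<noteq> 0 \<Longrightarrow> Poly_Mapping.keys m \<subseteq> V"
      by (auto simp: M_def A_def mpoly_ring_def ring_of_type_algebra_simps)
    then have "f = Poly_Mapping.lookup (Poly_Mapping.Abs_poly_mapping f)" by simp
    moreover from this have "Poly_Mapping.Abs_poly_mapping f \<in> poly_over V"
      using f(2) by (auto simp: poly_over_def in_keys_iff)
    ultimately show "f \<in> Poly_Mapping.lookup ` poly_over V" by blast
  qed
qed (auto simp: M_def A_def mpoly_ring_def ring_of_type_algebra_simps poly_over_def in_keys_iff)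

lemma lookup_in_carrier: "F \<in> poly_over V \<Longrightarrow> Poly_Mapping.lookup F \<in> carrier M"
  by (simp add: mpoly_ring_carrier)

lemma mpoly_ring_mult:
  "Poly_Mapping.lookup F \<otimes>\<^bsub>M\<^esub> Poly_Mapping.lookup G = Poly_Mapping.lookup (F * G)"
proof
  fix m
  have "(Poly_Mapping.lookup F \<otimes>\<^bsub>M\<^esub> Poly_Mapping.lookup G) m
      = (\<Sum>(a, b)\<in>{(a, b). a + b = m}. Poly_Mapping.lookup F a * Poly_Mapping.lookup G b)"
    by (simp add: M_def A_def mpoly_ring_def finsum_ring_of_type_algebra finite_sum_decompositions
        ring_of_type_algebra_simps)
  also have "\<dots> = (\<Sum>(a, b)\<in>{(a, b). a + b = m}. Poly_Mapping.lookup F a * Poly_Mapping.lookup G b when m = a + b)"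
    by (intro sum.cong) auto
  also have "\<dots> = Poly_Mapping.lookup (F * G) m"
    by (simp add: times_poly_mapping.rep_eq prod_fun_unfold_prod)
       (rule Sum_any.expand_superset[symmetric], auto intro: finite_sum_decompositions)
  finally show "(Poly_Mapping.lookup F \<otimes>\<^bsub>M\<^esub> Poly_Mapping.lookup G) m
      = Poly_Mapping.lookup (F * G) m" .
qed

lemma mpoly_ring_add:
  "Poly_Mapping.lookup F \<oplus>\<^bsub>M\<^esub> Poly_Mapping.lookup G = Poly_Mapping.lookup (F + G)"
  by (simp add: fun_eq_iff M_def A_def mpoly_ring_def ring_of_type_algebra_simps lookup_add)

lemma mpoly_ring_zero: "\<zero>\<^bsub>M\<^esub> = Poly_Mapping.lookup 0"
  by (simp add: fun_eq_iff M_def A_def mpoly_ring_def ring_of_type_algebra_simps)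

lemma mpoly_ring_one: "\<one>\<^bsub>M\<^esub> = Poly_Mapping.lookup 1"
  by (simp add: fun_eq_iff M_def A_def mpoly_ring_def ring_of_type_algebra_simps lookup_one when_def)

lemma comm_monoid_mpoly_ring: "comm_monoid M"
  by (rule comm_monoidI)
     (auto simp: mpoly_ring_carrier mpoly_ring_mult mpoly_ring_one mult_ac
       intro!: imageI poly_over_mult poly_over_one)

lemma abelian_monoid_mpoly_ring: "abelian_monoid M"
  by (rule abelian_monoidI)
     (auto simp: mpoly_ring_carrier mpoly_ring_add mpoly_ring_zero add_ac
       intro!: imageI poly_over_add poly_over_zero)

lemma finsum_mpoly_ring:
  assumes "finite I" "\<And>i. i \<in> I \<Longrightarrow> F i \<in> poly_over V"
  shows "(\<Oplus>\<^bsub>M\<^esub>i\<in>I. Poly_Mapping.lookup (F i)) = Poly_Mapping.lookup (\<Sum>i\<in>I. F i)"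
proof -
  interpret abelian_monoid M by (rule abelian_monoid_mpoly_ring)
  show ?thesis
    using assms
    by (induction I rule: finite_induct) (auto simp: mpoly_ring_zero mpoly_ring_add lookup_in_carrier)
qed

lemma finprod_mpoly_ring:
  assumes "finite I" "\<And>i. i \<in> I \<Longrightarrow> F i \<in> poly_over V"
  shows "finprod M (\<lambda>i. Poly_Mapping.lookup (F i)) I = Poly_Mapping.lookup (\<Prod>i\<in>I. F i)"
proof -
  interpret comm_monoid M by (rule comm_monoid_mpoly_ring)
  show ?thesis
    using assms
    by (induction I rule: finite_induct) (auto simp: mpoly_ring_one mpoly_ring_mult lookup_in_carrier)
qed

lemma nat_pow_mpoly_ring:
  "Poly_Mapping.lookup F [^]\<^bsub>M\<^esub> (n::nat) = Poly_Mapping.lookup (F ^ n)"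
proof -
  interpret comm_monoid M by (rule comm_monoid_mpoly_ring)
  show ?thesis
    by (induction n) (auto simp: mpoly_ring_one mpoly_ring_mult mult.commute)
qed

lemma A_const_eq: "A_const A c = Poly_Mapping.lookup (Poly_Mapping.single 0 c)"
  by (auto simp: fun_eq_iff A_const_def A_def ring_of_type_algebra_simps lookup_single when_def)

lemma A_var_eq: "A_var A i j = Poly_Mapping.lookup (Poly_Mapping.single (Poly_Mapping.single (i, j) 1) 1)"
  by (auto simp: fun_eq_iff A_var_def A_def ring_of_type_algebra_simps lookup_single when_def)

end

definition gl_form ::
    "nat \<Rightarrow> (nat \<Rightarrow> nat \<Rightarrow> 'r::comm_ring_1) \<Rightarrow> nat \<Rightarrow> nat \<Rightarrow> (monom \<Rightarrow>\<^sub>0 'r)" where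
  "gl_form N g i j =
     (if j \<in> {1..N}
      then \<Sum>l\<in>{1..N}. Poly_Mapping.single (Poly_Mapping.single (i, l) 1) (g l j)
      else Poly_Mapping.single (Poly_Mapping.single (i, j) 1) 1)"

lemma gl_form_poly_over:
  "(i, j) \<in> vars p \<Longrightarrow> gl_form N g i j \<in> poly_over (vars p)"
  by (auto simp: gl_form_def vars_def intro!: poly_over_sum poly_over_single)

lemma gl_var_eq:
  fixes g :: "nat \<Rightarrow> nat \<Rightarrow> 'r::comm_ring_1"
  assumes "(i, j) \<in> vars p"
  shows "gl_var p ring_of_type_algebra N g i j = Poly_Mapping.lookup (gl_form N g i j)"
proof (cases "j \<in> {1..N}")
  case True
  have "gl_var p ring_of_type_algebra N g i j
      = (\<Oplus>\<^bsub>mpoly_ring (vars p) ring_of_type_algebra\<^esub>l\<in>{1..N}.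
          Poly_Mapping.lookup (Poly_Mapping.single (Poly_Mapping.single (i, l) 1) (g l j)))"
    using True by (simp add: gl_var_def A_const_eq A_var_eq mpoly_ring_mult mult_single)
  also have "\<dots> = Poly_Mapping.lookup (\<Sum>l\<in>{1..N}. Poly_Mapping.single (Poly_Mapping.single (i, l) 1) (g l j))"
    using assms by (intro finsum_mpoly_ring) (auto simp: vars_def intro!: poly_over_single)
  finally show ?thesis using True by (simp add: gl_form_def)
qed (simp only: gl_var_def gl_form_def A_var_eq if_False)

lemma gl_act_eq:
  fixes F :: "monom \<Rightarrow>\<^sub>0 'r::comm_ring_1"
  assumes "F \<in> poly_over (vars p)"
  shows "gl_act p ring_of_type_algebra N g (Poly_Mapping.lookup F) = Poly_Mapping.lookup
    (\<Sum>m\<in>Poly_Mapping.keys F. Poly_Mapping.single 0 (Poly_Mapping.lookup F m) *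
      (\<Prod>(i, j)\<in>Poly_Mapping.keys m. gl_form N g i j ^ Poly_Mapping.lookup m (i, j)))"
proof -
  let ?M = "mpoly_ring (vars p) (ring_of_type_algebra :: 'r ring)"
  let ?t = "\<lambda>m (i, j). gl_form N g i j ^ Poly_Mapping.lookup m (i, j)"
  interpret comm_monoid ?M by (rule comm_monoid_mpoly_ring)
  interpret add: abelian_monoid ?M by (rule abelian_monoid_mpoly_ring)
  have t: "?t m v \<in> poly_over (vars p)"
    if "m \<in> Poly_Mapping.keys F" "v \<in> Poly_Mapping.keys m" for m v
    using assms that by (cases v) (auto simp: poly_over_def[of "vars p"]
        intro!: poly_over_power[unfolded poly_over_def, simplified] gl_form_poly_over[unfolded poly_over_def, simplified])
  have prod: "finprod ?M (\<lambda>(i, j). gl_var p ring_of_type_algebra N g i j [^]\<^bsub>?M\<^esub> Poly_Mapping.lookup m (i, j))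
        (Poly_Mapping.keys m) = Poly_Mapping.lookup (\<Prod>v\<in>Poly_Mapping.keys m. ?t m v)"
    if m: "m \<in> Poly_Mapping.keys F" for m
  proof -
    have "finprod ?M (\<lambda>(i, j). gl_var p ring_of_type_algebra N g i j [^]\<^bsub>?M\<^esub> Poly_Mapping.lookup m (i, j))
        (Poly_Mapping.keys m) = finprod ?M (\<lambda>v. Poly_Mapping.lookup (?t m v)) (Poly_Mapping.keys m)"
    proof (rule finprod_cong')
      show "(\<lambda>v. Poly_Mapping.lookup (?t m v)) \<in> Poly_Mapping.keys m \<rightarrow> carrier ?M"
        using t[OF m] by (auto simp: mpoly_ring_carrier)
      fix v assume v: "v \<in> Poly_Mapping.keys m"
      obtain i j where ij: "v = (i, j)" by (cases v)
      have "(i, j) \<in> vars p" using assms m v ij by (auto simp: poly_over_def)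
      then show "(case v of (i, j) \<Rightarrow> gl_var p ring_of_type_algebra N g i j [^]\<^bsub>?M\<^esub> Poly_Mapping.lookup m (i, j))
          = Poly_Mapping.lookup (?t m v)"
        by (simp add: ij gl_var_eq nat_pow_mpoly_ring)
    qed simp
    also have "\<dots> = Poly_Mapping.lookup (\<Prod>v\<in>Poly_Mapping.keys m. ?t m v)"
      using t[OF m] by (intro finprod_mpoly_ring) auto
    finally show ?thesis .
  qed
  have keys: "{m. Poly_Mapping.lookup F m \<noteq> \<zero>\<^bsub>ring_of_type_algebra\<^esub>} = Poly_Mapping.keys F"
    by (auto simp: ring_of_type_algebra_simps in_keys_iff)
  have mem: "Poly_Mapping.single 0 (Poly_Mapping.lookup F m) * (\<Prod>v\<in>Poly_Mapping.keys m. ?t m v)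
      \<in> poly_over (vars p)" if "m \<in> Poly_Mapping.keys F" for m
    using t[OF that] by (intro poly_over_mult poly_over_single poly_over_prod) auto
  have "gl_act p ring_of_type_algebra N g (Poly_Mapping.lookup F)
      = (\<Oplus>\<^bsub>?M\<^esub>m\<in>Poly_Mapping.keys F. Poly_Mapping.lookup
          (Poly_Mapping.single 0 (Poly_Mapping.lookup F m) * (\<Prod>v\<in>Poly_Mapping.keys m. ?t m v)))"
    unfolding gl_act_def Let_def keys
  proof (rule add.finsum_cong')
    show "(\<lambda>m. Poly_Mapping.lookup (Poly_Mapping.single 0 (Poly_Mapping.lookup F m)
        * (\<Prod>v\<in>Poly_Mapping.keys m. ?t m v))) \<in> Poly_Mapping.keys F \<rightarrow> carrier ?M"
      using mem by (auto simp: mpoly_ring_carrier)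
  qed (simp_all add: prod A_const_eq mpoly_ring_mult)
  also have "\<dots> = Poly_Mapping.lookup (\<Sum>m\<in>Poly_Mapping.keys F.
      Poly_Mapping.single 0 (Poly_Mapping.lookup F m) * (\<Prod>v\<in>Poly_Mapping.keys m. ?t m v))"
    using mem by (intro finsum_mpoly_ring) auto
  finally show ?thesis .
qed

lemma prod_single_one:
  "(\<Prod>i\<in>I. Poly_Mapping.single (f i) (1 :: 'r::comm_ring_1)) = Poly_Mapping.single (\<Sum>i\<in>I. f i) 1"
  for f :: "'i \<Rightarrow> 'n::comm_monoid_add"
  by (induction I rule: infinite_finite_induct) (auto simp: mult_single)

lemma tmul_mvar: "tmul d (mvar i j) = Poly_Mapping.single (Poly_Mapping.single (i, j) 1) (Poly_Mapping.single d 1)"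
  by (simp add: mvar_def tmul_single)

lemma is_subalgebra_unital_subring:
  fixes W :: "'k::field mpol set"
  assumes "is_subalgebra p W"
  shows "unital_subring W"
proof
  fix f assume "f \<in> W"
  then have "mconst (- 1) * f \<in> W" using assms by (simp add: is_subalgebra_def)
  moreover have "mconst (- 1) = (- 1 :: 'k mpol)"
    by (simp add: mconst_def single_uminus)
  ultimately show "- f \<in> W" by simp
qed (use assms in \<open>auto simp: is_subalgebra_def\<close>)

lemma coef_const_mult:
  fixes w :: "'n::comm_monoid_add \<Rightarrow>\<^sub>0 'k::comm_ring_1" and c :: "'m::cancel_comm_monoid_add \<Rightarrow>\<^sub>0 'k"
  shows "coef d (Poly_Mapping.single 0 c * tmul 0 w) = Poly_Mapping.single 0 (Poly_Mapping.lookup c d) * w"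
proof -
  have "coef d (Poly_Mapping.single (0 :: 'n) c) = Poly_Mapping.single 0 (Poly_Mapping.lookup c d)"
    by (rule poly_mapping_eqI) (auto simp: lookup_coef lookup_single when_def)
  then show ?thesis
    using coef_tmul_mult[of 0 d w "Poly_Mapping.single 0 c"] by (simp add: mult.commute)
qed

lemma keys_tmul: "Poly_Mapping.keys (tmul d w) = Poly_Mapping.keys (w :: 'n \<Rightarrow>\<^sub>0 'k::zero)"
proof -
  have "Poly_Mapping.single d a = 0 \<longleftrightarrow> a = 0" for a :: 'k
    by (metis lookup_single_eq lookup_zero single_zero)
  then show ?thesis by (simp add: set_eq_iff in_keys_iff lookup_tmul)
qed

section \<open>Base change of a subalgebra to \<open>k[t]\<close>\<close>

context
  fixes p :: nat and W :: "'k::field mpol set"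
  assumes W: "is_subalgebra p W"
begin

lemma base_change_eq:
  "base_change p ring_of_type_algebra (Poly_Mapping.single (0 :: nat \<Rightarrow>\<^sub>0 nat)) W
    = Poly_Mapping.lookup ` {\<Sum>w\<in>F. Poly_Mapping.single 0 (c w) * tmul 0 w | F c. finite F \<and> F \<subseteq> W}"
proof -
  let ?M = "mpoly_ring (vars p) (ring_of_type_algebra :: ((nat \<Rightarrow>\<^sub>0 nat) \<Rightarrow>\<^sub>0 'k) ring)"
  let ?w = "\<lambda>w m. Poly_Mapping.single (0 :: nat \<Rightarrow>\<^sub>0 nat) (Poly_Mapping.lookup w m)"
  have "(\<Oplus>\<^bsub>?M\<^esub>w\<in>F. A_const ring_of_type_algebra (c w) \<otimes>\<^bsub>?M\<^esub> ?w w)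
      = Poly_Mapping.lookup (\<Sum>w\<in>F. Poly_Mapping.single 0 (c w) * tmul 0 w)"
    if F: "finite F" "F \<subseteq> W" for F c
  proof -
    have "Poly_Mapping.single 0 (c w) * tmul 0 w \<in> poly_over (vars p)" if "w \<in> F" for w
    proof (intro poly_over_mult poly_over_single)
      have "w \<in> R_ring p" using that F W by (auto simp: is_subalgebra_def)
      then show "tmul 0 w \<in> poly_over (vars p)"
        by (simp add: poly_over_def R_ring_def keys_tmul)
    qed simp
    moreover have "A_const ring_of_type_algebra (c w) \<otimes>\<^bsub>?M\<^esub> ?w w
        = Poly_Mapping.lookup (Poly_Mapping.single 0 (c w) * tmul 0 w)" for w
    proof -
      have "?w w = Poly_Mapping.lookup (tmul 0 w)" by (simp add: fun_eq_iff lookup_tmul)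
      then show ?thesis by (simp only: A_const_eq mpoly_ring_mult)
    qed
    ultimately show ?thesis using F(1) by (simp add: finsum_mpoly_ring)
  qed
  then have "base_change p ring_of_type_algebra (Poly_Mapping.single (0 :: nat \<Rightarrow>\<^sub>0 nat)) W
      = {Poly_Mapping.lookup (\<Sum>w\<in>F. Poly_Mapping.single 0 (c w) * tmul 0 w) | F c. finite F \<and> F \<subseteq> W}"
    unfolding base_change_def Let_def
    by (intro Collect_cong ex_cong1) (auto simp: ring_of_type_algebra_simps)
  then show ?thesis by (simp only:) blast
qed

text \<open>Taking the coefficient at \<open>d\<close> turns a combination of elements of
  \<open>W\<close> with scalars in \<open>k[t]\<close> into one with scalars in
  \<open>k\<close>.\<close>

lemma coef_mem_of_base_change:
  assumes "Poly_Mapping.lookup E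
    \<in> base_change p ring_of_type_algebra (Poly_Mapping.single (0 :: nat \<Rightarrow>\<^sub>0 nat)) W"
  shows "coef d E \<in> W"
proof -
  interpret unital_subring W using W by (rule is_subalgebra_unital_subring)
  obtain E' where E': "Poly_Mapping.lookup E = Poly_Mapping.lookup E'"
      "E' \<in> {\<Sum>w\<in>F. Poly_Mapping.single 0 (c w) * tmul 0 w | F c. finite F \<and> F \<subseteq> W}"
    using assms unfolding base_change_eq by (rule imageE)
  moreover from E'(1) have "E = E'" by (simp only: poly_mapping_eq_iff)
  ultimately obtain F c where F: "E = (\<Sum>w\<in>F. Poly_Mapping.single 0 (c w) * tmul 0 w)" "F \<subseteq> W"
    by blast
  have "Poly_Mapping.single 0 (Poly_Mapping.lookup (c w) d) * w \<in> W" if "w \<in> F" for w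
    using that F(2) W by (auto simp: is_subalgebra_def mconst_def)
  then show ?thesis by (simp add: F(1) coef_sum coef_const_mult sum_mem)
qed

end

text \<open>Exponent of the product of the variables \<open>(i, 1)\<close> with \<open>i\<close> in
  \<open>I\<close>; here 1 is the second index, whereas \<open>row\<close> below fixes the
  first.\<close>

definition row1_monom :: "nat set \<Rightarrow> monom" where
  "row1_monom I = (\<Sum>i\<in>I. Poly_Mapping.single (i, 1) 1)"

lemma lookup_row1_monom:
  "finite I \<Longrightarrow> Poly_Mapping.lookup (row1_monom I) (i, j) = (if j = 1 \<and> i \<in> I then 1 else 0)"
  by (auto simp: row1_monom_def lookup_sum lookup_single when_def sum.delta cong: if_cong)

lemma keys_row1_monom: "finite I \<Longrightarrow> Poly_Mapping.keys (row1_monom I) = I \<times> {1}"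
  by (auto simp: in_keys_iff lookup_row1_monom split: if_splits)

text \<open>The action substitutes \<open>gl_form N g i 1\<close> for the variable
  \<open>(i, 1)\<close>. Its definition runs over the keys of a polynomial, which are matched here
  with the \<open>r\<close>-subsets of \<open>{1..p}\<close>.\<close>

lemma gl_act_elem_sym:
  fixes g :: "nat \<Rightarrow> nat \<Rightarrow> (nat \<Rightarrow>\<^sub>0 nat) \<Rightarrow>\<^sub>0 'k::field"
  shows "gl_act p ring_of_type_algebra N g (Poly_Mapping.lookup (tmul 0 (elem_sym p r 1)))
    = Poly_Mapping.lookup (esym (\<lambda>i. gl_form N g i 1) {1..p} r)"
proof -
  define Is where "Is = {I. I \<subseteq> {1..p} \<and> card I = r}"
  define E where "E = (elem_sym p r 1 :: 'k mpol)"
  have fin: "finite I" if "I \<in> Is" for I using that finite_subset by (auto simp: Is_def)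
  have finIs: "finite Is" by (auto simp: Is_def intro: finite_subset[of _ "Pow {1..p}"])
  have inj: "inj_on row1_monom Is"
    by (rule inj_onI) (metis fin keys_row1_monom fst_image_times insert_not_empty)
  have E_eq: "E = (\<Sum>I\<in>Is. Poly_Mapping.single (row1_monom I) 1)"
    by (simp add: E_def Is_def elem_sym_def mvar_def prod_single_one row1_monom_def)
  \<comment> \<open>Distinct index sets give distinct monomials, so every coefficient that occurs is
    1 and none cancel in characteristic \<open>p\<close>.\<close>
  have look: "Poly_Mapping.lookup E m = (if m \<in> row1_monom ` Is then 1 else 0)" for m
  proof -
    have "Poly_Mapping.lookup E m = (\<Sum>I\<in>Is. if row1_monom I = m then 1 else 0)"
      by (simp only: E_eq lookup_sum lookup_single when_def)
    also have "\<dots> = (\<Sum>m'\<in>row1_monom ` Is. if m' = m then 1 else 0)"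
      by (simp add: sum.reindex[OF inj])
    also have "\<dots> = (if m \<in> row1_monom ` Is then 1 else 0)"
      using finIs by (intro sum.delta) simp
    finally show ?thesis .
  qed
  have keys: "Poly_Mapping.keys (tmul (0 :: nat \<Rightarrow>\<^sub>0 nat) E) = row1_monom ` Is"
    by (auto simp: keys_tmul in_keys_iff look split: if_splits)
  have "Poly_Mapping.keys m \<subseteq> vars p" if m: "m \<in> Poly_Mapping.keys (tmul (0 :: nat \<Rightarrow>\<^sub>0 nat) E)" for m
  proof -
    obtain I where I: "I \<in> Is" "m = row1_monom I" using m keys by auto
    then show ?thesis using fin[OF I(1)] by (auto simp: keys_row1_monom vars_def Is_def)
  qed
  then have "tmul (0 :: nat \<Rightarrow>\<^sub>0 nat) E \<in> poly_over (vars p)"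
    by (simp add: poly_over_def)
  then have "gl_act p ring_of_type_algebra N g (Poly_Mapping.lookup (tmul 0 E)) = Poly_Mapping.lookup
    (\<Sum>m\<in>row1_monom ` Is. Poly_Mapping.single 0 (Poly_Mapping.lookup (tmul 0 E) m) *
      (\<Prod>(i, j)\<in>Poly_Mapping.keys m. gl_form N g i j ^ Poly_Mapping.lookup m (i, j)))"
    by (simp only: gl_act_eq keys)
  also have "(\<Sum>m\<in>row1_monom ` Is. Poly_Mapping.single 0 (Poly_Mapping.lookup (tmul 0 E) m) *
      (\<Prod>(i, j)\<in>Poly_Mapping.keys m. gl_form N g i j ^ Poly_Mapping.lookup m (i, j)))
    = (\<Sum>I\<in>Is. Poly_Mapping.single 0 (Poly_Mapping.lookup (tmul 0 E) (row1_monom I)) *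
      (\<Prod>(i, j)\<in>Poly_Mapping.keys (row1_monom I). gl_form N g i j ^ Poly_Mapping.lookup (row1_monom I) (i, j)))"
    by (rule sum.reindex[OF inj, unfolded o_def])
  also have "\<dots> = (\<Sum>I\<in>Is. \<Prod>i\<in>I. gl_form N g i 1)"
  proof (rule sum.cong[OF refl])
    fix I assume I: "I \<in> Is"
    have "(\<Prod>(i, j)\<in>Poly_Mapping.keys (row1_monom I). gl_form N g i j ^ Poly_Mapping.lookup (row1_monom I) (i, j))
        = (\<Prod>i\<in>I. \<Prod>j\<in>{1}. gl_form N g i j ^ Poly_Mapping.lookup (row1_monom I) (i, j))"
      unfolding keys_row1_monom[OF fin[OF I]] by (rule prod.cartesian_product[symmetric])
    also have "\<dots> = (\<Prod>i\<in>I. gl_form N g i 1)"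
      using fin[OF I] by (intro prod.cong refl) (simp add: lookup_row1_monom)
    finally show "Poly_Mapping.single 0 (Poly_Mapping.lookup (tmul 0 E) (row1_monom I)) *
      (\<Prod>(i, j)\<in>Poly_Mapping.keys (row1_monom I). gl_form N g i j ^ Poly_Mapping.lookup (row1_monom I) (i, j))
        = (\<Prod>i\<in>I. gl_form N g i 1)"
      using I by (simp add: lookup_tmul look)
  qed
  finally show ?thesis by (simp only: esym_def E_def Is_def)
qed

text \<open>The automorphism that sends \<open>e\<^sub>1\<close> to \<open>e\<^sub>1 + s\<^sub>2e\<^sub>2 + \<dots> + s\<^sub>Ne\<^sub>N\<close> and fixes the other \<open>e\<^sub>j\<close>.\<close>

definition transvection :: "(nat \<Rightarrow> 'r::comm_ring_1) \<Rightarrow> nat \<Rightarrow> nat \<Rightarrow> 'r" where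
  "transvection s l j = (if l = j then 1 else if j = 1 then s l else 0)"

lemma transvection_mult:
  assumes "i \<in> {1..N}" "j \<in> {1..N}"
  shows "(\<Sum>l\<in>{1..N}. transvection s i l * transvection (\<lambda>l. - s l) l j) = (if i = j then 1 else 0)"
proof -
  \<comment> \<open>Only \<open>l = i\<close> and \<open>l = 1\<close> contribute; the inner test on
    \<open>i\<close> avoids counting one index twice when \<open>i = 1\<close>.\<close>
  have "(\<Sum>l\<in>{1..N}. transvection s i l * transvection (\<lambda>l. - s l) l j)
      = (\<Sum>l\<in>{1..N}. (if l = i then transvection (\<lambda>l. - s l) i j else 0)
          + (if l = 1 then (if i = 1 then 0 else s i * transvection (\<lambda>l. - s l) 1 j) else 0))"
    by (intro sum.cong refl) (auto simp: transvection_def)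
  also have "\<dots> = (if i = j then 1 else 0)"
    using assms by (auto simp: sum.distrib sum.delta transvection_def)
  finally show ?thesis .
qed

lemma transvection_GL: "transvection s \<in> GL N ring_of_type_algebra"
  unfolding GL_def
  using transvection_mult[of _ N _ s] transvection_mult[of _ N _ "\<lambda>l. - s l"]
  by (auto simp: finsum_ring_of_type_algebra ring_of_type_algebra_simps
      intro!: exI[of _ "transvection (\<lambda>l. - s l)"])

lemma gl_form_transvection:
  assumes "N \<ge> 1"
  shows "gl_form N (transvection (\<lambda>l. Poly_Mapping.single (texp l 1) 1)) i 1
    = generic_form N (\<lambda>j. mvar i j :: 'k::field mpol)"
  using assms unfolding gl_form_def generic_form_def tmul_mvar
  by (auto simp: transvection_def texp_def intro!: sum.cong)

text \<open>Stability is applied for \<open>A = k[t]\<close> to a transvection whose entries are the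
  auxiliary variables; \<open>coef_mem_of_base_change\<close> leads back to
  \<open>W\<close>.\<close>

lemma coef_esym_mem:
  fixes W :: "'k::field mpol set"
  assumes W: "is_subalgebra p W" "gl_stable p W" "\<forall>r\<in>{1..p}. elem_sym p r 1 \<in> W" and N: "N \<ge> 1"
  shows "coef d (esym (\<lambda>i. generic_form N (mvar i)) {1..p} r) \<in> W"
proof -
  interpret unital_subring W using W(1) by (rule is_subalgebra_unital_subring)
  let ?A = "ring_of_type_algebra :: ((nat \<Rightarrow>\<^sub>0 nat) \<Rightarrow>\<^sub>0 'k) ring"
  let ?\<phi> = "Poly_Mapping.single (0 :: nat \<Rightarrow>\<^sub>0 nat) :: 'k \<Rightarrow> _"
  let ?g = "transvection (\<lambda>l. Poly_Mapping.single (texp l 1) 1) :: nat \<Rightarrow> nat \<Rightarrow> (nat \<Rightarrow>\<^sub>0 nat) \<Rightarrow>\<^sub>0 'k"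
  \<comment> \<open>The hypothesis on \<open>W\<close> covers \<open>r\<close> from 1 to
    \<open>p\<close>; outside this range \<open>esym\<close> is 1 or 0.\<close>
  consider "r = 0" | "r > p" | "r \<in> {1..p}" by fastforce
  then show ?thesis
  proof cases
    case 1
    then show ?thesis by (simp add: esym_0 coef_one one_mem zero_mem)
  next
    case 2
    then show ?thesis by (simp add: esym_eq_0 zero_mem)
  next
    case 3
    then have "elem_sym p r 1 \<in> W" using W(3) by blast
    then have "Poly_Mapping.lookup (tmul 0 (elem_sym p r 1)) \<in> base_change p ?A ?\<phi> W"
      unfolding base_change_eq[OF W(1)]
      by (auto intro!: imageI exI[of _ "{elem_sym p r 1}"] exI[of _ "\<lambda>_. 1"])
    moreover have "?\<phi> \<in> ring_hom ring_of_type_algebra ?A"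
      by (rule ring_hom_memI) (auto simp: ring_of_type_algebra_simps mult_single single_add)
    ultimately have "gl_act p ?A N ?g (Poly_Mapping.lookup (tmul 0 (elem_sym p r 1)))
        \<in> base_change p ?A ?\<phi> W"
      using W(2) N transvection_GL[of _ N] cring_from_type_algebra unfolding gl_stable_def by blast
    then have "Poly_Mapping.lookup (esym (\<lambda>i. generic_form N (mvar i)) {1..p} r) \<in> base_change p ?A ?\<phi> W"
      unfolding gl_act_elem_sym gl_form_transvection[OF N] .
    then show ?thesis by (rule coef_mem_of_base_change[OF W(1)])
  qed
qed

subsection \<open>Averaging over the symmetric group\<close>

text \<open>Composition with a transposition shows that all points of \<open>S\<close> give the same
  sum. The values are natural numbers because the factor \<open>card S\<close>, which is zero in
  \<open>k\<close> in the application, has to be cancelled.\<close>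

lemma sum_permutes_point:
  fixes g :: "nat \<Rightarrow> nat"
  assumes S: "finite S" and a: "a \<in> S"
  shows "(\<Sum>\<sigma> | \<sigma> permutes S. g (\<sigma> a)) = fact (card S - 1) * (\<Sum>k\<in>S. g k)"
proof -
  have indep: "(\<Sum>\<sigma> | \<sigma> permutes S. g (\<sigma> k)) = (\<Sum>\<sigma> | \<sigma> permutes S. g (\<sigma> a))" if k: "k \<in> S" for k
    by (rule sum.reindex_bij_witness[of _ "\<lambda>\<sigma>. \<sigma> \<circ> transpose a k" "\<lambda>\<sigma>. \<sigma> \<circ> transpose a k"])
       (use a k in \<open>auto simp: comp_assoc intro: permutes_compose permutes_swap_id\<close>)
  have pos: "card S > 0" using S a card_gt_0_iff by blast
  have "card S * (\<Sum>\<sigma> | \<sigma> permutes S. g (\<sigma> a)) = (\<Sum>k\<in>S. \<Sum>\<sigma> | \<sigma> permutes S. g (\<sigma> k))"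
    using indep by simp
  also have "\<dots> = (\<Sum>\<sigma> | \<sigma> permutes S. \<Sum>k\<in>S. g (\<sigma> k))"
    by (rule sum.swap)
  also have "\<dots> = (\<Sum>\<sigma> | \<sigma> permutes S. \<Sum>k\<in>S. g k)"
  proof (rule sum.cong[OF refl])
    fix \<sigma> assume "\<sigma> \<in> {\<sigma>. \<sigma> permutes S}"
    then show "(\<Sum>k\<in>S. g (\<sigma> k)) = (\<Sum>k\<in>S. g k)"
      using sum.permute[of \<sigma> S g] by (simp add: o_def)
  qed
  also have "\<dots> = fact (card S) * (\<Sum>k\<in>S. g k)"
    using S by (simp add: card_permutations)
  also have "\<dots> = card S * (fact (card S - 1) * (\<Sum>k\<in>S. g k))"
    using pos by (simp add: fact_reduce)
  finally show ?thesis using pos by simp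
qed

section \<open>Permuted monomials and their rows\<close>

definition perm_monom :: "(nat \<Rightarrow> nat) \<Rightarrow> monom \<Rightarrow> monom" where
  "perm_monom \<sigma> m = (\<Sum>(i, j)\<in>Poly_Mapping.keys m. Poly_Mapping.single (\<sigma> i, j) (Poly_Mapping.lookup m (i, j)))"

lemma lookup_perm_monom:
  assumes "inj \<sigma>"
  shows "Poly_Mapping.lookup (perm_monom \<sigma> m) (\<sigma> i, j) = Poly_Mapping.lookup m (i, j)"
proof -
  have "Poly_Mapping.lookup (perm_monom \<sigma> m) (\<sigma> i, j)
      = (\<Sum>v\<in>Poly_Mapping.keys m. if v = (i, j) then Poly_Mapping.lookup m (i, j) else 0)"
    unfolding perm_monom_def lookup_sum
    by (intro sum.cong refl) (auto simp: lookup_single when_def inj_eq[OF assms] split: if_splits)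
  also have "\<dots> = Poly_Mapping.lookup m (i, j)"
    by (simp add: sum.delta in_keys_iff)
  finally show ?thesis .
qed

lemma perm_monom_inv:
  assumes "\<sigma> permutes S"
  shows "perm_monom (inv_into UNIV \<sigma>) (perm_monom \<sigma> m) = m" "perm_monom \<sigma> (perm_monom (inv_into UNIV \<sigma>) m) = m"
proof -
  have inj: "inj \<sigma>" "inj (inv_into UNIV \<sigma>)"
    using assms permutes_inv permutes_inj by blast+
  note inverses = permutes_inverses[OF assms]
  show "perm_monom (inv_into UNIV \<sigma>) (perm_monom \<sigma> m) = m"
  proof (rule poly_mapping_eqI, clarify)
    fix i j
    show "Poly_Mapping.lookup (perm_monom (inv_into UNIV \<sigma>) (perm_monom \<sigma> m)) (i, j) = Poly_Mapping.lookup m (i, j)"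
      using lookup_perm_monom[OF inj(2), of "perm_monom \<sigma> m" "\<sigma> i" j] lookup_perm_monom[OF inj(1), of m i j]
      by (simp add: inverses)
  qed
  show "perm_monom \<sigma> (perm_monom (inv_into UNIV \<sigma>) m) = m"
  proof (rule poly_mapping_eqI, clarify)
    fix i j
    show "Poly_Mapping.lookup (perm_monom \<sigma> (perm_monom (inv_into UNIV \<sigma>) m)) (i, j) = Poly_Mapping.lookup m (i, j)"
      using lookup_perm_monom[OF inj(1), of "perm_monom (inv_into UNIV \<sigma>) m" "inv_into UNIV \<sigma> i" j]
        lookup_perm_monom[OF inj(2), of m i j]
      by (simp add: inverses)
  qed
qed

lemma mvar_power: "mvar i j ^ n = (Poly_Mapping.single (Poly_Mapping.single (i, j) n) 1 :: 'k::field mpol)"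
  by (induction n) (simp_all add: mvar_def mult_single flip: single_add)

lemma perm_act_eq:
  "perm_act \<sigma> f = (\<Sum>m\<in>Poly_Mapping.keys f. Poly_Mapping.single (perm_monom \<sigma> m) (Poly_Mapping.lookup f m))"
  for f :: "'k::field mpol"
proof -
  have "(\<Prod>(i, j)\<in>Poly_Mapping.keys m. mvar (\<sigma> i) j ^ Poly_Mapping.lookup m (i, j))
      = (Poly_Mapping.single (perm_monom \<sigma> m) 1 :: 'k mpol)" for m
    by (simp add: mvar_power perm_monom_def case_prod_unfold prod_single_one)
  then show ?thesis
    by (simp add: perm_act_def mconst_def mult_single)
qed

lemma lookup_perm_act:
  assumes "\<sigma> permutes S"
  shows "Poly_Mapping.lookup (perm_act \<sigma> f) (perm_monom \<sigma> m) = Poly_Mapping.lookup f m"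
proof -
  have "perm_monom \<sigma> m' = perm_monom \<sigma> m \<longleftrightarrow> m' = m" for m'
    using perm_monom_inv(1)[OF assms] by metis
  then have "Poly_Mapping.lookup (perm_act \<sigma> f) (perm_monom \<sigma> m)
      = (\<Sum>m'\<in>Poly_Mapping.keys f. if m' = m then Poly_Mapping.lookup f m' else 0)"
    by (simp add: perm_act_eq lookup_sum lookup_single when_def)
  also have "\<dots> = Poly_Mapping.lookup f m"
    by (simp add: sum.delta in_keys_iff)
  finally show ?thesis .
qed

definition row :: "monom \<Rightarrow> nat \<Rightarrow> nat \<Rightarrow> nat" where
  "row m i = (\<lambda>j. Poly_Mapping.lookup m (i, j))"

lemma row_perm_monom: "\<sigma> permutes S \<Longrightarrow> row (perm_monom \<sigma> m) (\<sigma> i) = row m i"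
  by (simp add: row_def lookup_perm_monom permutes_inj)

definition some_row :: "nat set \<Rightarrow> monom \<Rightarrow> nat \<Rightarrow> nat" where
  "some_row S m = (SOME v. v \<in> row m ` S)"

text \<open>The choice of a row depends only on the set of rows, hence is invariant under permutations, and
  the chosen row occurs a number of times that is invertible mod \<open>p\<close>. So the weights of the
  permutations of a monomial have sum \<open>(p - 1)!\<close>, which replaces a division by the order of the
  stabilizer.\<close>

definition weight :: "nat set \<Rightarrow> monom \<Rightarrow> 'k::field" where
  "weight S m = of_bool (row m 1 = some_row S m) / of_nat (card {i \<in> S. row m i = some_row S m})"

lemma image_row_perm_monom:
  assumes "\<sigma> permutes S"
  shows "row (perm_monom \<sigma> m) ` S = row m ` S"
proof -
  have "row (perm_monom \<sigma> m) ` S = row (perm_monom \<sigma> m) ` \<sigma> ` S"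
    using permutes_image[OF assms] by simp
  also have "\<dots> = row m ` S"
    by (simp add: image_image row_perm_monom[OF assms])
  finally show ?thesis .
qed

lemma some_row_perm_monom: "\<sigma> permutes S \<Longrightarrow> some_row S (perm_monom \<sigma> m) = some_row S m"
  by (simp add: some_row_def image_row_perm_monom)

lemma card_some_row_perm_monom:
  assumes "\<sigma> permutes S"
  shows "card {i \<in> S. row (perm_monom \<sigma> m) i = some_row S (perm_monom \<sigma> m)}
    = card {i \<in> S. row m i = some_row S m}"
proof -
  have "{i \<in> S. row (perm_monom \<sigma> m) i = some_row S m} = \<sigma> ` {i \<in> S. row m i = some_row S m}" (is "?A = ?B")
  proof
    show "?A \<subseteq> ?B"
    proof
      fix i assume i: "i \<in> ?A"
      have "i = \<sigma> (inv_into UNIV \<sigma> i)" using assms by (simp add: permutes_inverses)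
      moreover have "inv_into UNIV \<sigma> i \<in> S"
        using i assms permutes_in_image[OF permutes_inv[OF assms]] by auto
      moreover have "row m (inv_into UNIV \<sigma> i) = some_row S m"
        using i row_perm_monom[OF assms, of m "inv_into UNIV \<sigma> i"] assms by (simp add: permutes_inverses)
      ultimately show "i \<in> ?B" by blast
    qed
  qed (use assms in \<open>auto simp: row_perm_monom permutes_in_image\<close>)
  moreover have "inj_on \<sigma> {i \<in> S. row m i = some_row S m}"
    using assms permutes_inj_on by blast
  ultimately show ?thesis
    using assms by (simp add: some_row_perm_monom card_image)
qed

text \<open>By \<open>sum_permutes_point\<close> the numerators add up to
  \<open>fact (card S - 1)\<close> times the number of occurrences of the chosen row, and that
  number is the common denominator.\<close>

lemma sum_weight:
  assumes S: "finite S" "1 \<in> S" and CHAR: "CHAR('k::field) = card S"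
    and m: "\<not> (\<exists>v. row m ` S \<subseteq> {v})"
  shows "(\<Sum>\<sigma> | \<sigma> permutes S. weight S (perm_monom (inv_into UNIV \<sigma>) m) :: 'k) = of_nat (fact (card S - 1))"
proof -
  let ?v = "some_row S m" and ?I = "{i \<in> S. row m i = some_row S m}"
  have v: "?v \<in> row m ` S"
    unfolding some_row_def by (rule someI[of _ "row m 1"]) (use S(2) in blast)
  have "?I \<noteq> S"
  proof
    assume "?I = S"
    then have "row m i = ?v" if "i \<in> S" for i using that by blast
    then have "row m ` S \<subseteq> {?v}" by (simp add: image_subset_iff)
    then show False using m by (simp only: not_ex)
  qed
  then have "card ?I < card S" using S(1) by (intro psubset_card_mono) auto
  moreover have "card ?I > 0" using v S(1) by (auto simp: card_gt_0_iff)
  \<comment> \<open>Since the rows are not all equal, this number lies strictly between 0 and the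
    characteristic.\<close>
  ultimately have nz: "of_nat (card ?I) \<noteq> (0 :: 'k)"
    by (auto simp: of_nat_eq_0_iff_char_dvd CHAR dest: dvd_imp_le)
  have "weight S (perm_monom (inv_into UNIV \<sigma>) m) = (of_nat (of_bool (row m (\<sigma> 1) = ?v)) / of_nat (card ?I) :: 'k)"
    if \<sigma>: "\<sigma> permutes S" for \<sigma>
  proof -
    have inv: "inv_into UNIV \<sigma> permutes S" using \<sigma> by (rule permutes_inv)
    have "row (perm_monom (inv_into UNIV \<sigma>) m) 1 = row m (\<sigma> 1)"
      using row_perm_monom[OF inv, of m "\<sigma> 1"] \<sigma> by (simp add: permutes_inverses)
    then show ?thesis
      using some_row_perm_monom[OF inv, of m] card_some_row_perm_monom[OF inv, of m]
      by (simp add: weight_def)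
  qed
  then have "(\<Sum>\<sigma> | \<sigma> permutes S. weight S (perm_monom (inv_into UNIV \<sigma>) m) :: 'k)
      = of_nat (\<Sum>\<sigma> | \<sigma> permutes S. of_bool (row m (\<sigma> 1) = ?v)) / of_nat (card ?I)"
    by (simp add: sum_divide_distrib)
  also have "(\<Sum>\<sigma> | \<sigma> permutes S. of_bool (row m (\<sigma> 1) = ?v) :: nat) = fact (card S - 1) * (\<Sum>k\<in>S. of_bool (row m k = ?v))"
    using S by (rule sum_permutes_point[of S 1 "\<lambda>k. of_bool (row m k = ?v)"])
  also have "(\<Sum>k\<in>S. of_bool (row m k = ?v) :: nat) = card ?I"
    using S(1) by (simp add: of_bool_def sum.If_cases Int_def)
  finally show ?thesis using nz by simp
qed

lemma single_eq_prod_mvar: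
  assumes "Poly_Mapping.keys m \<subseteq> S \<times> {1..N}" "finite S"
  shows "Poly_Mapping.single m 1 = (\<Prod>i\<in>S. \<Prod>j\<in>{1..N}. mvar i j ^ row m i j :: 'k::field mpol)"
proof -
  have m: "(\<Sum>v\<in>S \<times> {1..N}. Poly_Mapping.single v (Poly_Mapping.lookup m v)) = m"
  proof -
    have "(\<Sum>v\<in>S \<times> {1..N}. Poly_Mapping.single v (Poly_Mapping.lookup m v))
        = (\<Sum>v\<in>Poly_Mapping.keys m. Poly_Mapping.single v (Poly_Mapping.lookup m v))"
      using assms by (intro sum.mono_neutral_right) (auto simp: in_keys_iff)
    then show ?thesis by (simp only: poly_mapping_sum_single)
  qed
  have "(\<Prod>i\<in>S. \<Prod>j\<in>{1..N}. mvar i j ^ row m i j :: 'k mpol)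
      = (\<Prod>v\<in>S \<times> {1..N}. Poly_Mapping.single (Poly_Mapping.single v (Poly_Mapping.lookup m v)) 1)"
    unfolding prod.cartesian_product by (intro prod.cong refl) (auto simp: mvar_power row_def)
  then show ?thesis by (simp only: prod_single_one m)
qed

theorem theorem2:
  fixes p :: nat and f :: "'k::field mpol"
  assumes "CHAR('k) = p" and "p > 0"
    and "f \<in> invariants p"
  shows "f ^ p \<in> polarizations p"
  unfolding polarizations_def
proof (intro InterI, clarify)
  fix W :: "'k mpol set"
  assume W: "is_subalgebra p W" "gl_stable p W" "\<forall>r\<in>{1..p}. elem_sym p r 1 \<in> W"
  have p: "prime p"
    using prime_CHAR_semidom[where 'a = 'k] assms(1,2) by simp
  define S where "S = {1..p}"
  define K where "K = Poly_Mapping.keys f"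
  define c where "c = Poly_Mapping.lookup f"
  \<comment> \<open>\<open>Suc\<close> keeps \<open>N\<close> positive even when no variable occurs
    and \<open>Max\<close> is taken of the empty set.\<close>
  define N where "N = Suc (Max (snd ` (\<Union>m\<in>K. Poly_Mapping.keys m)))"
  have rows: "finite S" "card S = p" "1 \<in> S" using assms(2) by (auto simp: S_def)
  have N: "N \<ge> 1" by (simp add: N_def)
  have keys: "Poly_Mapping.keys m \<subseteq> S \<times> {1..N}" if m: "m \<in> K" for m
  proof
    fix v assume v: "v \<in> Poly_Mapping.keys m"
    have "snd v \<le> Max (snd ` (\<Union>m\<in>K. Poly_Mapping.keys m))"
      using v m by (intro Max_ge) (auto simp: K_def)
    moreover have "v \<in> vars p"
      using assms(3) v m by (auto simp: invariants_def R_ring_def K_def)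
    ultimately show "v \<in> S \<times> {1..N}" by (auto simp: vars_def S_def N_def)
  qed
  interpret polarized W S p N mvar
  proof (intro polarized.intro is_subalgebra_unital_subring[OF W(1)], unfold_locales)
    show "coef d (esym (\<lambda>i. generic_form N (mvar i)) S r) \<in> W" for d r
      unfolding S_def by (rule coef_esym_mem[OF W N])
  qed (use rows p assms(1) in auto)
  have const: "mconst a * g \<in> W" if "g \<in> W" for a g
    using W(1) that by (simp add: is_subalgebra_def)
  have c_perm: "c (perm_monom \<sigma> m) = c m" if "\<sigma> permutes S" for \<sigma> m
    using lookup_perm_act[OF that, of f m] assms(3) that by (simp add: invariants_def S_def c_def)
  have K_perm: "perm_monom \<sigma> m \<in> K \<longleftrightarrow> m \<in> K" if "\<sigma> permutes S" for \<sigma> m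
    using c_perm[OF that, of m] by (simp add: K_def c_def in_keys_iff)

  \<comment> \<open>For \<open>m\<close> in \<open>K\<close>, \<open>Y m\<close> is the
    \<open>p\<close>-th power of the monomial \<open>m\<close>, arranged by rows.\<close>
  define Y :: "monom \<Rightarrow> 'k mpol" where "Y m = (\<Prod>i\<in>S. \<Prod>j\<in>{1..N}. (mvar i j ^ p) ^ row m i j)" for m
  have Y_perm: "Y (perm_monom \<sigma> m) = (\<Prod>i\<in>S. \<Prod>j\<in>{1..N}. (mvar (\<sigma> i) j ^ p) ^ row m i j)"
    if "\<sigma> permutes S" for \<sigma> m
    unfolding Y_def by (subst prod.permute[OF that]) (simp add: row_perm_monom[OF that])
  have Y_sum: "(\<Sum>\<sigma> | \<sigma> permutes S. Y (perm_monom \<sigma> m)) \<in> W" for m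
    using frobenius_symmetrized_mem[of "row m"] by (simp add: Y_perm)
  have Y_const: "Y m \<in> W" if "(\<exists>v. row m ` S \<subseteq> {v})" for m
  proof -
    from that obtain a where a: "\<forall>i\<in>S. row m i = a" by (auto simp: image_subset_iff)
    have "Y m = (\<Prod>j\<in>{1..N}. \<Prod>i\<in>S. (mvar i j ^ p) ^ a j)"
      unfolding Y_def by (subst prod.swap) (simp add: a)
    also have "\<dots> = (\<Prod>j\<in>{1..N}. ((\<Prod>i\<in>S. mvar i j) ^ p) ^ a j)"
      by (simp add: prod_power_distrib)
    also have "\<dots> \<in> W" by (intro prod_mem power_mem norm_mem)
    finally show ?thesis .
  qed
  have fp: "f ^ p = (\<Sum>m\<in>K. mconst (c m ^ p) * Y m)"
  proof -
    have "f ^ p = (\<Sum>m\<in>K. Poly_Mapping.single m (c m)) ^ p"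
      unfolding K_def c_def poly_mapping_sum_single ..
    also have "\<dots> = (\<Sum>m\<in>K. Poly_Mapping.single m (c m) ^ p)"
      by (rule freshmans_dream_sum) (simp_all add: CHAR_poly_mapping assms(1) p)
    also have "\<dots> = (\<Sum>m\<in>K. mconst (c m ^ p) * Y m)"
    proof (rule sum.cong[OF refl])
      fix m assume m: "m \<in> K"
      have "Poly_Mapping.single m (c m) = mconst (c m) * Poly_Mapping.single m 1"
        by (simp add: mconst_def mult_single)
      moreover have "mconst a ^ n = mconst (a ^ n)" for a :: 'k and n
        by (induction n) (simp_all add: mconst_def mult_single)
      moreover have "Poly_Mapping.single m (1 :: 'k) ^ p = Y m"
        unfolding single_eq_prod_mvar[OF keys[OF m] rows(1)] Y_def
        by (simp add: prod_power_distrib power_mult[symmetric] mult.commute)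
      ultimately show "Poly_Mapping.single m (c m) ^ p = mconst (c m ^ p) * Y m"
        by (simp add: power_mult_distrib)
    qed
    finally show ?thesis .
  qed

  define K1 where "K1 = {m \<in> K. \<not> (\<exists>v. row m ` S \<subseteq> {v})}"
  define F where "F = (\<Sum>m\<in>K1. mconst (c m ^ p) * Y m)"
  \<comment> \<open>The total weight from \<open>sum_weight\<close>; it is invertible because
    \<open>p\<close> does not divide \<open>(p - 1)!\<close>.\<close>
  define C :: 'k where "C = of_nat (fact (p - 1))"
  have C: "C \<noteq> 0"
    using p assms(2) by (simp add: C_def of_nat_eq_0_iff_char_dvd assms(1) prime_dvd_fact_iff del: of_nat_fact)
  have mconst_mult: "mconst (a * b) = mconst a * mconst b" for a b :: 'k
    by (simp add: mconst_def mult_single)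
  have mconst_sum: "mconst (sum g A) = (\<Sum>a\<in>A. mconst (g a))" for g :: "'x \<Rightarrow> 'k" and A
    by (induction A rule: infinite_finite_induct) (auto simp: mconst_def single_add)
  have K1_perm: "perm_monom \<sigma> m \<in> K1 \<longleftrightarrow> m \<in> K1" if "\<sigma> permutes S" for \<sigma> m
  proof -
    show ?thesis
      unfolding K1_def by (simp only: mem_Collect_eq K_perm[OF that] image_row_perm_monom[OF that])
  qed
  \<comment> \<open>No orbit representatives are chosen. \<open>C\<close> is spread over the
    permutations as a sum of weights; since the coefficients of \<open>f\<close> are invariant,
    reindexing \<open>K1\<close> moves each permutation from the weight to \<open>Y\<close>. What
    remains next to each weight is a full symmetrization, in \<open>W\<close> by
    \<open>Y_sum\<close>.\<close>
  have "mconst C * F = (\<Sum>m\<in>K1. mconst C * (mconst (c m ^ p) * Y m))"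
    by (simp add: F_def sum_distrib_left)
  also have "\<dots> = (\<Sum>m\<in>K1. \<Sum>\<sigma> | \<sigma> permutes S. mconst (weight S (perm_monom (inv_into UNIV \<sigma>) m)) * (mconst (c m ^ p) * Y m))"
  proof (rule sum.cong[OF refl])
    fix m assume "m \<in> K1"
    then have "C = (\<Sum>\<sigma> | \<sigma> permutes S. weight S (perm_monom (inv_into UNIV \<sigma>) m))"
      using sum_weight[OF rows(1,3), where 'k = 'k, of m] rows(2) assms(1)
      by (simp add: K1_def C_def del: One_nat_def)
    then show "mconst C * (mconst (c m ^ p) * Y m)
      = (\<Sum>\<sigma> | \<sigma> permutes S. mconst (weight S (perm_monom (inv_into UNIV \<sigma>) m)) * (mconst (c m ^ p) * Y m))"
      by (simp only: mconst_sum sum_distrib_right)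
  qed
  also have "\<dots> = (\<Sum>\<sigma> | \<sigma> permutes S. \<Sum>m\<in>K1. mconst (weight S (perm_monom (inv_into UNIV \<sigma>) m)) * (mconst (c m ^ p) * Y m))"
    by (rule sum.swap)
  also have "\<dots> = (\<Sum>\<sigma> | \<sigma> permutes S. \<Sum>m\<in>K1. mconst (weight S m) * (mconst (c m ^ p) * Y (perm_monom \<sigma> m)))"
  proof (rule sum.cong[OF refl])
    fix \<sigma> assume "\<sigma> \<in> {\<sigma>. \<sigma> permutes S}"
    then have \<sigma>: "\<sigma> permutes S" by simp
    show "(\<Sum>m\<in>K1. mconst (weight S (perm_monom (inv_into UNIV \<sigma>) m)) * (mconst (c m ^ p) * Y m))
      = (\<Sum>m\<in>K1. mconst (weight S m) * (mconst (c m ^ p) * Y (perm_monom \<sigma> m)))"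
      by (rule sum.reindex_bij_witness[of _ "perm_monom \<sigma>" "perm_monom (inv_into UNIV \<sigma>)"])
         (use K1_perm[OF permutes_inv[OF \<sigma>]] in
           \<open>simp_all add: perm_monom_inv[OF \<sigma>] K1_perm[OF \<sigma>] c_perm[OF permutes_inv[OF \<sigma>]]\<close>)
  qed
  also have "\<dots> = (\<Sum>m\<in>K1. mconst (weight S m) * (mconst (c m ^ p) * (\<Sum>\<sigma> | \<sigma> permutes S. Y (perm_monom \<sigma> m))))"
    by (subst sum.swap) (simp only: sum_distrib_left)
  also have "\<dots> \<in> W"
    by (intro sum_mem const Y_sum)
  finally have "mconst (1 / C) * (mconst C * F) \<in> W"
    by (rule const)
  moreover have "mconst (1 / C) * (mconst C * F) = F"
    using C by (simp add: mult.assoc[symmetric] mconst_mult[symmetric]) (simp add: mconst_def)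
  ultimately have "F \<in> W" by simp
  moreover have "(\<Sum>m\<in>K - K1. mconst (c m ^ p) * Y m) \<in> W"
    by (intro sum_mem const Y_const) (auto simp: K1_def)
  moreover have "f ^ p = (\<Sum>m\<in>K - K1. mconst (c m ^ p) * Y m) + F"
    unfolding fp F_def by (rule sum.subset_diff) (auto simp: K1_def K_def)
  ultimately show "f ^ p \<in> W" by (simp add: add_mem)
qed

end
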